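(* Let $p>1$, $\beta=1/(p-1)$ and $\gamma=\frac{p-2}{2(p-1)}$. There exists a positive ancient solution $u$ of the half-space problem $u_t-\Delta u=|\nabla u|^p$ in $\mathbb{R}^n_+\times(-\infty,0)$, $u=0$ on $\partial\mathbb{R}^n_+\times(-\infty,0)$, which is not stationary. Namely, $u$ can be taken of the form $$u(x,t)=|t|^\gamma\,\phi\Big(\frac{x_n}{\sqrt{|t|}}\Big),\qquad (x,t)\in\mathbb{R}^n_+\times(-\infty,0),$$ where $\phi\in C^2([0,\infty))$ satisfies $\phi(0)=0$, $\phi'>0$ on $[0,\infty)$ and $\lim_{y\to\infty}\phi(y)/y^{\beta+1}=L$ for some $L>0$.
   Context: $\mathbb{R}^n_+:=\{x\in\mathbb{R}^n: x_n>0\}$. An ancient solution of the half-space problem is a function $u\in C^{2,1}(Q)\cap C(\overline Q)$, $Q=\mathbb{R}^n_+\times(-\infty,0)$, satisfying the PDE pointwise in $Q$ and $u=0$ pointwise on $\partial\mathbb{R}^n_+\times(-\infty,0)$.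
   Formalization: Continuity on the closure of Q is required only for t<0 (closed half-space times (-∞,0)), not at t=0: any u of the stated form behaves like L x_n^{β+1}|t|^{-β} and blows up as t→0-, so it cannot be continuous up to t=0. *)

theory Defs
  imports "HOL-Analysis.Analysis"
begin

text \<open>Space-time functions u :: real^'n => real => real, u x t.
  The half-space normal direction is the coordinate k (playing the role of x_n).\<close>

definition halfQ :: "'n::finite \<Rightarrow> ((real^'n) \<times> real) set" where
  "halfQ k = {(x, t). x $ k > 0 \<and> t < 0}"

definition halfQbar :: "'n::finite \<Rightarrow> ((real^'n) \<times> real) set" where
  "halfQbar k = {(x, t). x $ k \<ge> 0 \<and> t < 0}"

definition dx :: "'n::finite \<Rightarrow> (real^'n \<Rightarrow> real \<Rightarrow> real) \<Rightarrow> real^'n \<Rightarrow> real \<Rightarrow> real" where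
  "dx i u x t = deriv (\<lambda>s. u (x + s *\<^sub>R axis i 1) t) 0"

definition dt :: "(real^'n::finite \<Rightarrow> real \<Rightarrow> real) \<Rightarrow> real^'n \<Rightarrow> real \<Rightarrow> real" where
  "dt u x t = deriv (\<lambda>s. u x (t + s)) 0"

definition C21_on :: "((real^'n::finite) \<times> real) set \<Rightarrow> (real^'n \<Rightarrow> real \<Rightarrow> real) \<Rightarrow> bool" where
  "C21_on Q u \<longleftrightarrow>
     continuous_on Q (\<lambda>(x, t). u x t) \<and>
     (\<forall>(x, t)\<in>Q. \<forall>i. (\<lambda>s. u (x + s *\<^sub>R axis i 1) t) field_differentiable (at 0)) \<and>
     (\<forall>(x, t)\<in>Q. \<forall>i j. (\<lambda>s. dx j u (x + s *\<^sub>R axis i 1) t) field_differentiable (at 0)) \<and>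
     (\<forall>(x, t)\<in>Q. (\<lambda>s. u x (t + s)) field_differentiable (at 0)) \<and>
     (\<forall>i. continuous_on Q (\<lambda>(x, t). dx i u x t)) \<and>
     (\<forall>i j. continuous_on Q (\<lambda>(x, t). dx i (dx j u) x t)) \<and>
     continuous_on Q (\<lambda>(x, t). dt u x t)"

definition grad_norm :: "(real^'n::finite \<Rightarrow> real \<Rightarrow> real) \<Rightarrow> real^'n \<Rightarrow> real \<Rightarrow> real" where
  "grad_norm u x t = sqrt (\<Sum>i\<in>UNIV. (dx i u x t)\<^sup>2)"

definition laplacian :: "(real^'n::finite \<Rightarrow> real \<Rightarrow> real) \<Rightarrow> real^'n \<Rightarrow> real \<Rightarrow> real" where
  "laplacian u x t = (\<Sum>i\<in>UNIV. dx i (dx i u) x t)"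

definition ancient_solution :: "real \<Rightarrow> 'n::finite \<Rightarrow> (real^'n \<Rightarrow> real \<Rightarrow> real) \<Rightarrow> bool" where
  "ancient_solution p k u \<longleftrightarrow>
     C21_on (halfQ k) u \<and>
     continuous_on (halfQbar k) (\<lambda>(x, t). u x t) \<and>
     (\<forall>(x, t)\<in>halfQ k. dt u x t - laplacian u x t = grad_norm u x t powr p) \<and>
     (\<forall>x t. x $ k = 0 \<and> t < 0 \<longrightarrow> u x t = 0)"

end

theory Submission
  imports Defs
begin

text \<open>
  The ansatz reduces the equation to \<open>\<phi>'' = y \<phi>' / 2 - \<gamma> \<phi> - \<phi>'\<^sup>p\<close> with \<open>\<phi> 0 = 0\<close>, \<open>\<phi>' 0 > 0\<close>; every
  positive initial slope works, and we take slope 1. Write \<open>v = \<phi>'\<close>. Then \<open>E = y v / 2 - \<gamma> \<phi>\<close> satisfies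
  \<open>E' = h / 2\<close> with \<open>h = \<beta> v + y v'\<close>, and \<open>v' = E - v\<^sup>p\<close>. At a first zero of \<open>h\<close> one would have
  \<open>g = y v\<^bsup>p-1\<^esup> > \<beta>\<close> (because \<open>h = y E + v (\<beta> - g)\<close> and \<open>E > 0\<close>) and hence
  \<open>h' = p (\<beta> - g) v' > 0\<close>, which is absurd. So \<open>h > 0\<close> and \<open>E > 0\<close>; the latter keeps \<open>v\<close> above a
  solution of \<open>l' = - l\<^sup>p\<close>, hence positive, and \<open>v\<close> is global.

  For the behaviour at infinity put \<open>r = y v' / v > - \<beta>\<close> and \<open>S = p v\<^bsup>p-1\<^esup> / y\<close>. Then
  \<open>y S' = S (r - \<beta>) / \<beta>\<close> and \<open>y r' = r - r\<^sup>2 + y\<^sup>2 (\<beta>/2 + (1/2 - S) r)\<close>: for large \<open>y\<close> the variable \<open>r\<close> is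
  fast, it is pushed above \<open>\<beta>\<close> where \<open>S < 1\<close> and below \<open>\<beta>\<close> where \<open>S > 1\<close>, and this drives \<open>S\<close> to 1.
\<close>

section \<open>Global solutions of ordinary differential equations\<close>

text \<open>Successive Picard iterates differ by at most \<open>C * ((L * t) ^ n / fact n)\<close>
  on \<open>{0..T}\<close>, so they converge uniformly there and the integral equation passes to the
  limit. Each \<open>T\<close> may have its own Lipschitz constant.\<close>

lemma global_picard_lindelof:
  fixes f :: "real \<Rightarrow> 'a::banach \<Rightarrow> 'a"
  assumes cont: "\<And>x. continuous_on {0..} x \<Longrightarrow> continuous_on {0..} (\<lambda>t. f t (x t))"
    and lip: "\<And>T. T \<ge> 0 \<Longrightarrow> \<exists>L\<ge>0. \<forall>t\<in>{0..T}. \<forall>x y. norm (f t x - f t y) \<le> L * norm (x - y)"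
  obtains x where "x 0 = x0"
    and "\<And>t. t \<ge> 0 \<Longrightarrow> (x has_vector_derivative f t (x t)) (at t within {0..})"
proof -
  define X where "X = rec_nat (\<lambda>t. x0) (\<lambda>_ x t. x0 + integral {0..t} (\<lambda>s. f s (x s)))"
  have X0: "X 0 = (\<lambda>t. x0)"
    and XS: "X (Suc n) = (\<lambda>t. x0 + integral {0..t} (\<lambda>s. f s (X n s)))" for n
    by (simp_all add: X_def)
  have cont_int: "continuous_on {0..} (\<lambda>t. integral {0..t} g)"
    if g: "continuous_on {0..} g" for g :: "real \<Rightarrow> 'a"
    unfolding continuous_on_eq_continuous_within
  proof
    fix t :: real assume "t \<in> {0..}"
    have "g integrable_on {0..t+1}"
      by (intro integrable_continuous_real continuous_on_subset[OF g]) auto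
    then have "continuous (at t within {0..t+1}) (\<lambda>t. integral {0..t} g)"
      using indefinite_integral_continuous_1 \<open>t \<in> {0..}\<close>
      by (fastforce simp: continuous_on_eq_continuous_within)
    moreover have "at t within {0..t+1} = at t within {0..}"
      by (rule at_within_nhd[where S="{..<t+1}"]) auto
    ultimately show "continuous (at t within {0..}) (\<lambda>t. integral {0..t} g)"
      by (simp add: continuous_within)
  qed
  have contX: "continuous_on {0..} (X n)" for n
  proof (induction n)
    case (Suc n)
    show ?case
      unfolding XS by (intro continuous_on_add continuous_on_const cont_int cont[OF Suc])
  qed (simp add: X0)
  have contfX: "continuous_on S (\<lambda>s. f s (X n s))" if "S \<subseteq> {0..}" for n S
    using cont[OF contX] that by (rule continuous_on_subset)
  have contf0: "continuous_on S (\<lambda>s. f s x0)" if "S \<subseteq> {0..}" for S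
    using contfX[of S 0] that by (simp add: X0)
  \<comment> \<open>The limit is written as a telescoping series so that the Weierstrass test
    applies.\<close>
  define x where "x t = x0 + (\<Sum>n. X (Suc n) t - X n t)" for t
  have telescope: "X n t = x0 + (\<Sum>i<n. X (Suc i) t - X i t)" for n t
    using sum_lessThan_telescope[of "\<lambda>i. X i t" n] by (simp add: X0)
  have lim: "uniform_limit {0..T} X x sequentially" and
    limf: "uniform_limit {0..T} (\<lambda>n t. f t (X n t)) (\<lambda>t. f t (x t)) sequentially" if T: "T \<ge> 0" for T
  proof -
    obtain L where L: "L \<ge> 0" "\<And>t x y. t \<in> {0..T} \<Longrightarrow> norm (f t x - f t y) \<le> L * norm (x - y)"
      using lip[OF T] by blast
    have "compact ((\<lambda>t. f t x0) ` {0..T})"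
      using contf0[of "{0..T}"] by (simp add: compact_continuous_image)
    then have "bounded ((\<lambda>t. f t x0) ` {0..T})" by (rule compact_imp_bounded)
    then obtain M where M: "M > 0" "\<And>t. t \<in> {0..T} \<Longrightarrow> norm (f t x0) \<le> M"
      unfolding bounded_pos by blast
    define C where "C = M * T"
    have int: "(\<lambda>s. f s (X n s)) integrable_on {0..t}" for n t
      by (rule integrable_continuous_real[OF contfX]) auto
    have step: "norm (X (Suc n) t - X n t) \<le> C * ((L * t) ^ n / fact n)" if "t \<in> {0..T}" for n t
      using that
    proof (induction n arbitrary: t)
      case 0
      have "norm (integral {0..t} (\<lambda>s. f s x0)) \<le> M * (t - 0)"
        using 0 M by (intro integral_bound[OF _ contf0]) auto
      also have "\<dots> \<le> C" using 0 M by (simp add: C_def)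
      finally show ?case by (simp add: XS X0)
    next
      case (Suc n)
      have "((\<lambda>s. C * ((L * s) ^ Suc n / fact (Suc n))) has_real_derivative
          L * (C * ((L * s) ^ n / fact n))) (at s within {0..t})" for s
      proof -
        have "((\<lambda>s. C * ((L * s) ^ Suc n / fact (Suc n))) has_real_derivative
            C * (real (Suc n) * (L * s) ^ n * L / (real (Suc n) * fact n))) (at s within {0..t})"
          by (auto intro!: derivative_eq_intros simp del: power_Suc of_nat_Suc)
        then show ?thesis
          by (simp add: mult_ac del: of_nat_Suc)
      qed
      then have "((\<lambda>s. L * (C * ((L * s) ^ n / fact n))) has_integral
          C * ((L * t) ^ Suc n / fact (Suc n)) - C * ((L * 0) ^ Suc n / fact (Suc n))) {0..t}"
        using Suc.prems
        by (intro fundamental_theorem_of_calculus)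
           (auto simp: has_real_derivative_iff_has_vector_derivative[symmetric] simp del: power_Suc fact_Suc)
      then have I: "((\<lambda>s. L * (C * ((L * s) ^ n / fact n))) has_integral
          C * ((L * t) ^ Suc n / fact (Suc n))) {0..t}" by simp
      have "X (Suc (Suc n)) t - X (Suc n) t = integral {0..t} (\<lambda>s. f s (X (Suc n) s) - f s (X n s))"
        by (subst integral_diff[OF int int]) (simp add: XS)
      also have "norm \<dots> \<le> integral {0..t} (\<lambda>s. L * (C * ((L * s) ^ n / fact n)))"
      proof (rule integral_norm_bound_integral)
        show "(\<lambda>s. f s (X (Suc n) s) - f s (X n s)) integrable_on {0..t}"
          by (intro integrable_diff int)
        fix s assume s: "s \<in> {0..t}"
        then have "norm (f s (X (Suc n) s) - f s (X n s)) \<le> L * norm (X (Suc n) s - X n s)"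
          using Suc.prems by (intro L) auto
        also have "\<dots> \<le> L * (C * ((L * s) ^ n / fact n))"
          using Suc s by (intro mult_left_mono L Suc.IH) auto
        finally show "norm (f s (X (Suc n) s) - f s (X n s)) \<le> L * (C * ((L * s) ^ n / fact n))" .
      qed (use I in blast)
      finally show ?case unfolding integral_unique[OF I] .
    qed
    have "norm (X (Suc n) t - X n t) \<le> C * ((L * T) ^ n / fact n)" if "t \<in> {0..T}" for n t
      using step[OF that, of n] that L(1) M(1) T
      by (elim order_trans) (intro mult_left_mono divide_right_mono power_mono, auto simp: C_def)
    moreover have "summable (\<lambda>n. C * ((L * T) ^ n / fact n))"
      using summable_exp_generic[of "L * T"] by (intro summable_mult) (simp add: divide_inverse mult.commute)
    ultimately have "uniform_limit {0..T} (\<lambda>n t. \<Sum>i<n. X (Suc i) t - X i t)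
        (\<lambda>t. \<Sum>i. X (Suc i) t - X i t) sequentially"
      by (rule Weierstrass_m_test)
    from uniform_limit_add[OF uniform_limit_const this]
    show lim: "uniform_limit {0..T} X x sequentially"
      by (rule uniform_limit_cong'[THEN iffD1, rotated -1]) (simp_all add: x_def telescope[symmetric])
    show "uniform_limit {0..T} (\<lambda>n t. f t (X n t)) (\<lambda>t. f t (x t)) sequentially"
    proof (rule uniform_limitI)
      fix e :: real assume "e > 0"
      \<comment> \<open>\<open>L + 1\<close> is used because \<open>L\<close> may be zero.\<close>
      then have "e / (L + 1) > 0" using L(1) by simp
      from uniform_limitD[OF lim this]
      show "\<forall>\<^sub>F n in sequentially. \<forall>t\<in>{0..T}. dist (f t (X n t)) (f t (x t)) < e"
      proof (rule eventually_mono, intro ballI)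
        fix n t assume *: "\<forall>t\<in>{0..T}. dist (X n t) (x t) < e / (L + 1)" and t: "t \<in> {0..T}"
        have "dist (f t (X n t)) (f t (x t)) \<le> L * dist (X n t) (x t)"
          using L(2)[OF t] by (simp add: dist_norm)
        also have "\<dots> \<le> (L + 1) * dist (X n t) (x t)" by (intro mult_right_mono) auto
        also have "\<dots> < e" using * t L(1) by (auto simp: field_simps)
        finally show "dist (f t (X n t)) (f t (x t)) < e" .
      qed
    qed
  qed
  have contx: "continuous_on {0..T} x" if "T \<ge> 0" for T
    by (rule uniform_limit_theorem[OF _ lim[OF that]])
       (auto intro!: always_eventually continuous_on_subset[OF contX])
  have contfx: "continuous_on {0..T} (\<lambda>t. f t (x t))" if "T \<ge> 0" for T
    by (rule uniform_limit_theorem[OF _ limf[OF that]])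
       (simp_all add: always_eventually contfX)
  have x_eq: "x t = x0 + integral {0..t} (\<lambda>s. f s (x s))" if t: "t \<ge> 0" for t
  proof -
    have "continuous_on {0..t} (\<lambda>s. f s (X n s))" for n by (rule contfX) simp
    from uniform_limit_integral[OF limf[OF t] this sequentially_bot]
    obtain I J where IJ: "\<And>n. ((\<lambda>s. f s (X n s)) has_integral I n) {0..t}"
      "((\<lambda>s. f s (x s)) has_integral J) {0..t}" "I \<longlonglongrightarrow> J"
      by blast
    have "(\<lambda>n. X (Suc n) t) \<longlonglongrightarrow> x0 + J"
      using tendsto_add[OF tendsto_const IJ(3)] by (simp add: XS integral_unique[OF IJ(1)])
    moreover have "(\<lambda>n. X (Suc n) t) \<longlonglongrightarrow> x t"
      using tendsto_uniform_limitI[OF lim[OF t], of t] t by (intro LIMSEQ_Suc) auto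
    ultimately show ?thesis using IJ(2) LIMSEQ_unique by (auto simp: integral_unique)
  qed
  show thesis
  proof (rule that)
    show "x 0 = x0" using x_eq[of 0] by simp
    fix t :: real assume t: "t \<ge> 0"
    have "((\<lambda>t. x0 + integral {0..t} (\<lambda>s. f s (x s))) has_vector_derivative 0 + f t (x t))
        (at t within {0..t+1})"
      using t by (intro has_vector_derivative_add has_vector_derivative_const
          integral_has_vector_derivative contfx) auto
    then have "(x has_vector_derivative f t (x t)) (at t within {0..t+1})"
      using t by (intro has_vector_derivative_transform[where g=x]) (auto simp: x_eq)
    moreover have "at t within {0..t+1} = at t within {0..}"
      by (rule at_within_nhd[where S="{..<t+1}"]) auto
    ultimately show "(x has_vector_derivative f t (x t)) (at t within {0..})"
      by simp
  qed
qed

section \<open>Trapping arguments\<close>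

text \<open>A positive left derivative makes \<open>f\<close> smaller just before \<open>T\<close>.
  In the barrier arguments below this contradicts positivity before a first zero.\<close>

lemma negative_before_increasing_zero:
  fixes f :: "real \<Rightarrow> real"
  assumes "(f has_real_derivative D) (at T within {a..T})" "D > 0" "a < T" "f T = 0"
  shows "\<exists>y\<in>{a..<T}. f y < 0"
proof -
  obtain d where d: "d > 0" "\<And>h. h > 0 \<Longrightarrow> T - h \<in> {a..T} \<Longrightarrow> h < d \<Longrightarrow> f (T - h) < f T"
    using has_real_derivative_pos_inc_left[OF assms(1,2)] by blast
  define h where "h = min (d/2) (T - a)"
  have "h > 0" "h < d" "T - h \<in> {a..<T}"
    using d(1) assms(3) by (auto simp: h_def)
  then show ?thesis using d(2)[of h] assms(4) by (intro bexI[of _ "T - h"]) auto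
qed

text \<open>The set of points of \<open>{a..y}\<close> with \<open>f \<le> 0\<close> is closed,
  hence has a least point, and \<open>f\<close> vanishes there by the intermediate value theorem. A
  failure of positivity thus produces a first zero.\<close>

lemma positive_if_no_first_zero:
  fixes f :: "real \<Rightarrow> real"
  assumes cont: "continuous_on {a..} f" and pos: "f a > 0"
    and no_zero: "\<And>T. T > a \<Longrightarrow> (\<And>y. y \<in> {a..<T} \<Longrightarrow> f y > 0) \<Longrightarrow> f T = 0 \<Longrightarrow> False"
    and y: "y \<ge> a"
  shows "f y > 0"
proof (rule ccontr)
  assume neg: "\<not> f y > 0"
  define Z where "Z = {z \<in> {a..y}. f z \<le> 0}"
  have "closed Z" unfolding Z_def
    by (intro continuous_on_closed_Collect_le continuous_on_const continuous_on_subset[OF cont]) auto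
  moreover have Z: "y \<in> Z" "bdd_below Z" using y neg by (auto simp: Z_def intro!: bdd_belowI[of _ a])
  ultimately have T: "Inf Z \<in> Z" by (intro closed_contains_Inf) auto
  define T where "T = Inf Z"
  have T': "a \<le> T" "f T \<le> 0" "T \<le> y" using T by (auto simp: Z_def T_def)
  have "T \<noteq> a" using T' pos by auto
  have below: "f z > 0" if "z \<in> {a..<T}" for z
  proof (rule ccontr)
    assume "\<not> f z > 0"
    then have "z \<in> Z" using that T' by (auto simp: Z_def)
    then show False using that cInf_lower[OF _ Z(2)] by (force simp: T_def)
  qed
  obtain z where z: "z \<in> {a..T}" "f z = 0"
    using IVT2'[of f T 0 a] T' pos continuous_on_subset[OF cont, of "{a..T}"] by auto
  then have "z = T" using below[of z] by force
  then show False using no_zero[of T] below z T' \<open>T \<noteq> a\<close> by auto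
qed

text \<open>On each edge of the quadrant the derivative points strictly inwards, so a curve starting
  inside never reaches the boundary. The weak inequalities in the edge conditions cover the
  corner.\<close>

lemma trapped_positive_pair:
  fixes f g :: "real \<Rightarrow> real"
  assumes Df: "\<And>y. y \<ge> a \<Longrightarrow> (f has_real_derivative f' y) (at y)"
    and Dg: "\<And>y. y \<ge> a \<Longrightarrow> (g has_real_derivative g' y) (at y)"
    and init: "f a > 0" "g a > 0"
    and f': "\<And>y. y > a \<Longrightarrow> f y = 0 \<Longrightarrow> g y \<ge> 0 \<Longrightarrow> f' y > 0"
    and g': "\<And>y. y > a \<Longrightarrow> g y = 0 \<Longrightarrow> f y \<ge> 0 \<Longrightarrow> g' y > 0"
    and y: "y \<ge> a"
  shows "f y > 0 \<and> g y > 0"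
proof -
  have "min (f y) (g y) > 0"
  proof (rule positive_if_no_first_zero[where f="\<lambda>y. min (f y) (g y)" and a=a])
    show "continuous_on {a..} (\<lambda>y. min (f y) (g y))"
      using Df Dg by (intro continuous_intros continuous_at_imp_continuous_on) (auto dest: DERIV_isCont)
  next
    fix T assume T: "T > a" "\<And>y. y \<in> {a..<T} \<Longrightarrow> min (f y) (g y) > 0" and 0: "min (f T) (g T) = 0"
    have pos: "\<not> (\<exists>y\<in>{a..<T}. f y < 0)" "\<not> (\<exists>y\<in>{a..<T}. g y < 0)"
      using T(2) by (auto simp: not_less intro!: less_imp_le)
    have D: "(f has_real_derivative f' T) (at T within {a..T})"
      "(g has_real_derivative g' T) (at T within {a..T})"
      using T(1) by (auto intro!: has_field_derivative_at_within Df Dg)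
    consider "f T = 0" "g T \<ge> 0" | "g T = 0" "f T \<ge> 0" using 0 by linarith
    then show False
    proof cases
      case 1
      then show ?thesis using negative_before_increasing_zero[OF D(1) f' T(1)] T(1) pos by blast
    next
      case 2
      then show ?thesis using negative_before_increasing_zero[OF D(2) g' T(1)] T(1) pos by blast
    qed
  qed (use init y in auto)
  then show ?thesis by simp
qed

lemma trapped_positive:
  fixes f :: "real \<Rightarrow> real"
  assumes "\<And>y. y \<ge> a \<Longrightarrow> (f has_real_derivative f' y) (at y)" "f a > 0"
    and "\<And>y. y > a \<Longrightarrow> f y = 0 \<Longrightarrow> f' y > 0" "y \<ge> a"
  shows "f y > 0"
  using trapped_positive_pair[of a f f' f f' y] assms by blast

text \<open>Comparison with \<open>c * ln y\<close>, which diverges.\<close>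

lemma unbounded_if_deriv_ge_inverse:
  fixes f :: "real \<Rightarrow> real"
  assumes D: "\<And>y. y \<ge> a \<Longrightarrow> (f has_real_derivative f' y) (at y)"
    and ge: "\<And>y. y \<ge> a \<Longrightarrow> f' y \<ge> c / y" and "c > 0" "a > 0"
  shows "\<exists>y\<ge>a. f y > B"
proof -
  \<comment> \<open>With this \<open>K\<close>, \<open>c * ln\<close> gains
    \<open>\<bar>B - f a\<bar> + 1\<close> between \<open>a\<close> and
    \<open>a * exp K\<close>.\<close>
  define K where "K = (\<bar>B - f a\<bar> + 1) / c"
  define y where "y = a * exp K"
  have K: "K > 0" using \<open>c > 0\<close> by (simp add: K_def)
  then have y: "y \<ge> a" using \<open>a > 0\<close> by (simp add: y_def)
  have "f a - c * ln a \<le> f y - c * ln y"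
  proof (rule DERIV_nonneg_imp_nondecreasing[OF y])
    fix z assume "a \<le> z" "z \<le> y"
    then show "\<exists>d. ((\<lambda>z. f z - c * ln z) has_real_derivative d) (at z) \<and> 0 \<le> d"
      using ge[of z] \<open>a > 0\<close>
      by (intro exI[of _ "f' z - c / z"]) (auto intro!: derivative_eq_intros D)
  qed
  moreover have "ln y = ln a + K" using \<open>a > 0\<close> by (simp add: y_def ln_mult)
  ultimately have "f y \<ge> f a + c * K" by (simp add: algebra_simps)
  moreover have "c * K = \<bar>B - f a\<bar> + 1" using \<open>c > 0\<close> by (simp add: K_def)
  ultimately show ?thesis using y by (intro exI[of _ y]) auto
qed

section \<open>The logarithmic derivative at infinity\<close>

text \<open>The right-hand side is the factor of \<open>y\<close> in \<open>r'\<close>. It is at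
  least \<open>\<beta> / 2\<close> if \<open>1/2 - S\<close> and \<open>r\<close> have the same
  sign; otherwise the worst cases are the corner \<open>S = 1 - \<epsilon>\<close>,
  \<open>r = \<beta> * (1 + \<epsilon>)\<close> and the edge \<open>r = - \<beta>\<close>, where it
  equals \<open>\<beta> * S\<close>. The minimum remains because \<open>S\<close> may be
  small.\<close>

lemma slow_drift_lower:
  fixes \<beta> \<epsilon> r S :: real
  assumes "\<beta> > 0" "0 < \<epsilon>" "\<epsilon> \<le> 1/2" "0 < S" "S \<le> 1 - \<epsilon>" "-\<beta> < r" "r \<le> \<beta> * (1 + \<epsilon>)"
  shows "min (\<epsilon> * \<beta> / 2) (\<beta> * S) \<le> \<beta> / 2 + (1/2 - S) * r"
proof -
  have triv: "\<epsilon> * \<beta> / 2 \<le> \<beta> / 2" using assms by simp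
  consider "r \<ge> 0" "S \<le> 1/2" | "r < 0" "S \<ge> 1/2" | "r \<ge> 0" "S > 1/2" | "r < 0" "S < 1/2" by linarith
  then show ?thesis
  proof cases
    case 1
    then have "(1/2 - S) * r \<ge> 0" by simp
    then show ?thesis using triv by linarith
  next
    case 2
    then have "(1/2 - S) * r \<ge> 0" by (intro mult_nonpos_nonpos) auto
    then show ?thesis using triv by linarith
  next
    case 3
    have "(S - 1/2) * r \<le> (1/2 - \<epsilon>) * (\<beta> * (1 + \<epsilon>))" using 3 assms by (intro mult_mono) auto
    also have "\<dots> = \<beta> / 2 - \<epsilon> * \<beta> / 2 - \<beta> * \<epsilon>\<^sup>2" by (simp add: algebra_simps power2_eq_square)
    also have "\<dots> \<le> \<beta> / 2 - \<epsilon> * \<beta> / 2" using assms by simp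
    finally show ?thesis by (simp add: algebra_simps min_le_iff_disj)
  next
    case 4
    have "(1/2 - S) * (-\<beta>) \<le> (1/2 - S) * r" using 4 assms by (intro mult_left_mono) auto
    then show ?thesis by (simp add: algebra_simps min_le_iff_disj)
  qed
qed

text \<open>The product \<open>(S - 1/2) * r\<close> is smallest at the corner
  \<open>S = 1 + \<epsilon>\<close>, \<open>r = \<beta> * (1 - \<epsilon>/2)\<close>, and there it
  still exceeds \<open>\<beta> / 2\<close> by at least
  \<open>\<epsilon> * \<beta> / 2\<close>.\<close>

lemma slow_drift_upper:
  fixes \<beta> \<epsilon> r S :: real
  assumes "\<beta> > 0" "0 < \<epsilon>" "\<epsilon> \<le> 1/2" "1 + \<epsilon> \<le> S" "\<beta> * (1 - \<epsilon>/2) \<le> r"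
  shows "\<beta> / 2 + (1/2 - S) * r \<le> - (\<epsilon> * \<beta> / 2)"
proof -
  have "(1/2 + \<epsilon>) * (\<beta> * (1 - \<epsilon>/2)) \<le> (S - 1/2) * r" using assms by (intro mult_mono) auto
  moreover have "(1/2 + \<epsilon>) * (\<beta> * (1 - \<epsilon>/2)) = \<beta> / 2 + \<epsilon> * \<beta> / 2 + \<epsilon> * \<beta> / 2 * (1/2 - \<epsilon>)"
    by (simp add: field_simps power2_eq_square)
  moreover have "\<epsilon> * \<beta> / 2 * (1/2 - \<epsilon>) \<ge> 0" using assms by simp
  moreover have "(1/2 - S) * r = - ((S - 1/2) * r)" by (simp add: algebra_simps)
  ultimately show ?thesis by linarith
qed

text \<open>The planar system for \<open>r = y * v' / v\<close> and
  \<open>S = p * v powr (p - 1) / y\<close>, detached from the profile. \<open>g_top\<close> makes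
  the drift bound \<open>\<beta> * S\<close>, once multiplied by \<open>y\<^sup>2\<close>, beat
  every constant.\<close>

locale log_derivative_system =
  fixes \<beta> :: real and r S :: "real \<Rightarrow> real"
  assumes \<beta>: "\<beta> > 0"
    and S_pos: "\<And>y. y \<ge> 1 \<Longrightarrow> S y > 0"
    and r_gt: "\<And>y. y \<ge> 1 \<Longrightarrow> r y > - \<beta>"
    and DS: "\<And>y. y \<ge> 1 \<Longrightarrow> (S has_real_derivative S y * (r y - \<beta>) / (\<beta> * y)) (at y)"
    and Dr: "\<And>y. y \<ge> 1 \<Longrightarrow>
      (r has_real_derivative (r y - (r y)\<^sup>2) / y + y * (\<beta> / 2 + (1/2 - S y) * r y)) (at y)"
    and g_top: "filterlim (\<lambda>y. y\<^sup>2 * S y) at_top at_top"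
begin

section \<open>Drift estimates and lower trapping of \<open>S\<close>\<close>

lemma D_ln_S: "y \<ge> 1 \<Longrightarrow> ((\<lambda>y. ln (S y)) has_real_derivative (r y - \<beta>) / (\<beta> * y)) (at y)"
  using S_pos[of y] by (auto intro!: derivative_eq_intros DS)

text \<open>As \<open>r\<close> lies between \<open>- \<beta>\<close> and \<open>R\<close>, the part
  \<open>r - r\<^sup>2\<close> costs at most \<open>\<beta> + (max \<beta> R)\<^sup>2\<close>.
  Everything is put over \<open>y\<close> to compare with \<open>1 / y\<close>.\<close>

lemma r_deriv_ge:
  assumes y: "y \<ge> 1" and r: "r y \<le> R" "R \<ge> 0"
    and b: "c \<le> y\<^sup>2 * (\<beta> / 2 + (1/2 - S y) * r y)"
  shows "(c - \<beta> - (max \<beta> R)\<^sup>2) / y \<le> (r y - (r y)\<^sup>2) / y + y * (\<beta> / 2 + (1/2 - S y) * r y)"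
proof -
  have "\<bar>r y\<bar> \<le> max \<beta> R" using r_gt[OF y] r by linarith
  then have "(r y)\<^sup>2 \<le> (max \<beta> R)\<^sup>2" using power_mono[of "\<bar>r y\<bar>" "max \<beta> R" 2] by simp
  then have "c - \<beta> - (max \<beta> R)\<^sup>2 \<le> r y - (r y)\<^sup>2 + y\<^sup>2 * (\<beta> / 2 + (1/2 - S y) * r y)"
    using r_gt[OF y] b by linarith
  then have "(c - \<beta> - (max \<beta> R)\<^sup>2) / y
      \<le> (r y - (r y)\<^sup>2 + y\<^sup>2 * (\<beta> / 2 + (1/2 - S y) * r y)) / y"
    using y by (intro divide_right_mono) auto
  also have "\<dots> = (r y - (r y)\<^sup>2) / y + y * (\<beta> / 2 + (1/2 - S y) * r y)"
    using y by (simp add: add_divide_distrib power2_eq_square)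
  finally show ?thesis .
qed

text \<open>From above the quadratic part is harmless: \<open>r - r\<^sup>2 \<le> 1\<close> for
  every real \<open>r\<close>.\<close>

lemma r_deriv_le:
  assumes y: "y \<ge> 1" and b: "\<beta> / 2 + (1/2 - S y) * r y \<le> - c"
  shows "(r y - (r y)\<^sup>2) / y + y * (\<beta> / 2 + (1/2 - S y) * r y) \<le> (1 - y\<^sup>2 * c) / y"
proof -
  have "2 * r y \<le> (r y)\<^sup>2 + 1" using zero_le_power2[of "r y - 1"] by (simp add: power2_diff)
  moreover have "(r y)\<^sup>2 \<ge> 0" by simp
  ultimately have "r y - (r y)\<^sup>2 \<le> 1" by linarith
  then have "r y - (r y)\<^sup>2 + y\<^sup>2 * (\<beta> / 2 + (1/2 - S y) * r y) \<le> 1 + y\<^sup>2 * (- c)"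
    using b by (intro add_mono mult_left_mono) auto
  then have "(r y - (r y)\<^sup>2 + y\<^sup>2 * (\<beta> / 2 + (1/2 - S y) * r y)) / y \<le> (1 + y\<^sup>2 * (- c)) / y"
    using y by (intro divide_right_mono) auto
  then show ?thesis using y by (simp add: add_divide_distrib power2_eq_square)
qed

text \<open>If \<open>S < 1 - \<epsilon>\<close> persisted, the drift would lift \<open>r\<close>
  past \<open>R > \<beta>\<close> and keep it away from \<open>\<beta>\<close>; then
  \<open>ln S\<close> would grow at least like a multiple of \<open>ln y\<close>, and
  \<open>S\<close> would exceed 1.\<close>

lemma S_frequently_ge:
  assumes \<epsilon>: "0 < \<epsilon>" "\<epsilon> \<le> 1/2" and Y: "Y \<ge> 1"
  shows "\<exists>y\<ge>Y. S y \<ge> 1 - \<epsilon>"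
proof (rule ccontr)
  assume "\<not> ?thesis"
  then have S: "S y < 1 - \<epsilon>" if "y \<ge> Y" for y using that by force
  define R where "R = \<beta> * (1 + \<epsilon>)"
  have R: "R > 0" "\<beta> * \<epsilon> > 0" using \<beta> \<epsilon> by (simp_all add: R_def)
  \<comment> \<open>\<open>K\<close> exceeds the loss in \<open>r_deriv_ge\<close> by 1, which gives
    \<open>r' \<ge> 1 / y\<close> as long as \<open>r \<le> R\<close>.\<close>
  define K where "K = 1 + \<beta> + (max \<beta> R)\<^sup>2"
  have "\<forall>\<^sub>F y in at_top. y\<^sup>2 * S y \<ge> K / \<beta>"
    using g_top by (simp add: filterlim_at_top)
  moreover have "\<forall>\<^sub>F y in at_top. (y::real) \<ge> max Y (2 * K / (\<epsilon> * \<beta>))"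
    by (rule eventually_ge_at_top)
  ultimately have "\<forall>\<^sub>F y in at_top. y\<^sup>2 * S y \<ge> K / \<beta> \<and> y \<ge> max Y (2 * K / (\<epsilon> * \<beta>))"
    by eventually_elim auto
  then obtain Y1 where Y1: "\<And>y. y \<ge> Y1 \<Longrightarrow> y\<^sup>2 * S y \<ge> K / \<beta> \<and> y \<ge> max Y (2 * K / (\<epsilon> * \<beta>))"
    by (auto simp: eventually_at_top_linorder)
  have Y1': "Y1 \<ge> Y" "Y1 \<ge> 1" using Y1[of Y1] Y by auto
  have r': "1 / y \<le> (r y - (r y)\<^sup>2) / y + y * (\<beta> / 2 + (1/2 - S y) * r y)"
    if y: "y \<ge> Y1" and r: "r y \<le> R" for y
  proof -
    have y1: "y \<ge> 1" "y \<ge> Y" using y Y1' by auto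
    have "min (\<epsilon> * \<beta> / 2) (\<beta> * S y) \<le> \<beta> / 2 + (1/2 - S y) * r y"
      using r S[of y] y1 S_pos r_gt by (intro slow_drift_lower \<beta> \<epsilon>) (auto simp: R_def)
    then have "y\<^sup>2 * min (\<epsilon> * \<beta> / 2) (\<beta> * S y) \<le> y\<^sup>2 * (\<beta> / 2 + (1/2 - S y) * r y)"
      by (intro mult_left_mono) auto
    moreover have "y\<^sup>2 * (\<beta> * S y) \<ge> K" using Y1[OF y] \<beta> by (simp add: field_simps)
    moreover have "y\<^sup>2 * (\<epsilon> * \<beta> / 2) \<ge> K"
    proof -
      have "K \<le> y * (\<epsilon> * \<beta> / 2)" using Y1[OF y] \<beta> \<epsilon> by (simp add: field_simps)
      also have "\<dots> \<le> y\<^sup>2 * (\<epsilon> * \<beta> / 2)"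
        using \<beta> \<epsilon> y1 by (intro mult_right_mono) (auto simp: power2_eq_square)
      finally show ?thesis .
    qed
    ultimately have "K \<le> y\<^sup>2 * (\<beta> / 2 + (1/2 - S y) * r y)" by (auto simp: min_def split: if_splits)
    from r_deriv_ge[OF y1(1) r _ this] R show ?thesis by (simp add: K_def)
  qed
  have "\<exists>y0\<ge>Y1. r y0 > R"
  proof (rule ccontr)
    assume "\<not> ?thesis"
    then have "r y \<le> R" if "y \<ge> Y1" for y using that by force
    moreover from this have "\<exists>y\<ge>Y1. r y > R"
      by (intro unbounded_if_deriv_ge_inverse[OF Dr, of Y1 1]) (use r' Y1' in auto)
    ultimately show False by force
  qed
  then obtain y0 where y0: "y0 \<ge> Y1" "r y0 > R" by blast
  \<comment> \<open>The barrier lies below \<open>R\<close>, where \<open>r\<close> is increasing,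
    and still \<open>\<beta> * \<epsilon> / 2\<close> above \<open>\<beta>\<close>.\<close>
  have r_large: "r y > R - \<beta> * \<epsilon> / 2" if "y \<ge> y0" for y
  proof -
    have "r y - (R - \<beta> * \<epsilon> / 2) > 0"
    proof (rule trapped_positive[of y0 "\<lambda>y. r y - (R - \<beta> * \<epsilon> / 2)"])
      fix z assume z: "z > y0" "r z - (R - \<beta> * \<epsilon> / 2) = 0"
      have "1 / z > 0" using z y0 Y1' by simp
      also have "1 / z \<le> (r z - (r z)\<^sup>2) / z + z * (\<beta> / 2 + (1/2 - S z) * r z)"
        using z y0 R by (intro r') auto
      finally show "0 < (r z - (r z)\<^sup>2) / z + z * (\<beta> / 2 + (1/2 - S z) * r z) - 0" by simp
    next
      fix z assume z: "z \<ge> y0"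
      show "((\<lambda>y. r y - (R - \<beta> * \<epsilon> / 2)) has_real_derivative
           (r z - (r z)\<^sup>2) / z + z * (\<beta> / 2 + (1/2 - S z) * r z) - 0) (at z)"
        using z y0 Y1' by (intro DERIV_diff Dr DERIV_const) auto
    qed (use that y0 R in auto)
    then show ?thesis by simp
  qed
  have "\<exists>y\<ge>y0. ln (S y) > 0"
  proof (rule unbounded_if_deriv_ge_inverse[OF D_ln_S, of y0 "\<epsilon> / 2"])
    fix y assume y: "y \<ge> y0"
    have "\<epsilon> / 2 * \<beta> \<le> r y - \<beta>" using r_large[OF y] by (simp add: R_def algebra_simps)
    then have "\<epsilon> / 2 * \<beta> / (\<beta> * y) \<le> (r y - \<beta>) / (\<beta> * y)"
      using \<beta> y y0 Y1' by (intro divide_right_mono) auto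
    then show "\<epsilon> / 2 / y \<le> (r y - \<beta>) / (\<beta> * y)" using \<beta> by simp
  qed (use y0 Y1' \<epsilon> in auto)
  then obtain y where y: "y \<ge> y0" "ln (S y) > 0" by blast
  then have "S y > 1" using S_pos[of y] y0 Y1' by simp
  then show False using S[of y] y y0 Y1' \<epsilon> by simp
qed

text \<open>
  The trapping region is cut off at its corner by a line of small slope \<open>\<kappa>\<close> in the \<open>(r, S)\<close> plane: on that
  line \<open>S\<close> moves at speed \<open>O(1/y)\<close> only, while \<open>r\<close> moves at speed of order \<open>y\<close>.
\<close>
lemma S_eventually_trapped_below:
  assumes \<epsilon>: "0 < \<epsilon>" "\<epsilon> \<le> 1/2"
  shows "\<exists>Y\<ge>1. \<forall>y0\<ge>Y. S y0 \<ge> 1 - \<epsilon>/2 \<longrightarrow> (\<forall>y\<ge>y0. S y > 1 - \<epsilon>)"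
proof -
  \<comment> \<open>From \<open>r > - \<beta>\<close> and \<open>R < 2 * \<beta>\<close> follows
    \<open>\<kappa> * (R - r) < 3 * \<beta> * \<kappa> = \<epsilon> / 2\<close>, so a start with
    \<open>S \<ge> 1 - \<epsilon>/2\<close> lies strictly inside both barriers.\<close>
  define \<kappa> where "\<kappa> = \<epsilon> / (6 * \<beta>)"
  define R where "R = \<beta> * (1 + \<epsilon>/2)"
  have R: "R > 0" "R < 2 * \<beta>" using \<beta> \<epsilon> by (auto simp: R_def)
  have \<kappa>: "\<kappa> > 0" "\<kappa> * (R + \<beta>) < \<epsilon> / 2" using \<beta> \<epsilon> R by (auto simp: \<kappa>_def field_simps)
  define M where "M = \<beta> + (max \<beta> R)\<^sup>2"
  \<comment> \<open>Beyond \<open>Y\<close> the gain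
    \<open>\<kappa> * z\<^sup>2 * (\<epsilon> * \<beta> / 4)\<close> exceeds
    \<open>2 + \<kappa> * M\<close>, the combined loss from \<open>S'\<close> and from the quadratic
    part of \<open>r'\<close>.\<close>
  define Y where "Y = 1 + (3 + \<kappa> * M) / (\<kappa> * (\<epsilon> * \<beta> / 4))"
  have M: "M > 0" using \<beta> by (simp add: M_def add_pos_nonneg)
  have Y: "Y \<ge> 1" using \<beta> \<epsilon> \<kappa> M by (simp add: Y_def)
  show ?thesis
  proof (intro exI[of _ Y] conjI Y allI impI)
    fix y0 y :: real assume y0: "Y \<le> y0" "1 - \<epsilon> / 2 \<le> S y0" and y: "y0 \<le> y"
    have ge1: "z \<ge> 1" if "z \<ge> y0" for z using that y0 Y by linarith
    let ?S' = "\<lambda>z. S z * (r z - \<beta>) / (\<beta> * z)"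
    let ?r' = "\<lambda>z. (r z - (r z)\<^sup>2) / z + z * (\<beta> / 2 + (1/2 - S z) * r z)"
    have "S y - (1 - \<epsilon>) > 0 \<and> S y - \<kappa> * (R - r y) - (1 - \<epsilon>) > 0"
    proof (rule trapped_positive_pair[of y0 "\<lambda>z. S z - (1 - \<epsilon>)" ?S'
        "\<lambda>z. S z - \<kappa> * (R - r z) - (1 - \<epsilon>)" "\<lambda>z. ?S' z + \<kappa> * ?r' z"])
      show "((\<lambda>z. S z - (1 - \<epsilon>)) has_real_derivative ?S' z) (at z)" if "z \<ge> y0" for z
        using ge1[OF that] by (auto intro!: derivative_eq_intros DS)
      show "((\<lambda>z. S z - \<kappa> * (R - r z) - (1 - \<epsilon>)) has_real_derivative ?S' z + \<kappa> * ?r' z) (at z)"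
        if "z \<ge> y0" for z
        using ge1[OF that] by (auto intro!: derivative_eq_intros DS Dr simp: algebra_simps)
      have "\<kappa> * (R - r y0) < \<epsilon> / 2"
        using \<kappa> r_gt[OF ge1[of y0]] by (intro le_less_trans[OF _ \<kappa>(2)] mult_left_mono) auto
      then show "S y0 - \<kappa> * (R - r y0) - (1 - \<epsilon>) > 0" using y0 by simp
    next
      \<comment> \<open>On the edge \<open>S = 1 - \<epsilon>\<close> the sloping barrier forces
        \<open>r \<ge> R > \<beta>\<close>, so \<open>S\<close> increases.\<close>
      fix z assume z: "z > y0" "S z - (1 - \<epsilon>) = 0" "0 \<le> S z - \<kappa> * (R - r z) - (1 - \<epsilon>)"
      then have "r z \<ge> R" using \<kappa> by (simp add: zero_le_mult_iff mult_le_0_iff)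
      then have "r z > \<beta>" using \<beta> \<epsilon> by (simp add: R_def algebra_simps less_le_trans[rotated])
      then show "?S' z > 0" using z \<beta> S_pos[of z] ge1[of z] by auto
    next
      \<comment> \<open>On the sloping edge \<open>r \<le> R\<close> and
        \<open>1/2 \<le> S \<le> 1 - \<epsilon>/2\<close>, so \<open>slow_drift_lower\<close>
        applies with \<open>\<epsilon>/2\<close>.\<close>
      fix z assume z: "z > y0" "S z - \<kappa> * (R - r z) - (1 - \<epsilon>) = 0" "0 \<le> S z - (1 - \<epsilon>)"
      have z1: "z \<ge> 1" using z ge1 by auto
      have "\<kappa> * (R - r z) \<ge> 0" using z by linarith
      then have rR: "r z \<le> R" using \<kappa> by (simp add: zero_le_mult_iff)
      have "\<kappa> * (R - r z) < \<epsilon> / 2"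
        using \<kappa> r_gt[OF z1] by (intro le_less_trans[OF _ \<kappa>(2)] mult_left_mono) auto
      then have S: "S z \<le> 1 - \<epsilon>/2" "S z \<ge> 1/2" using z \<epsilon> by auto
      have "min (\<epsilon>/2 * \<beta> / 2) (\<beta> * S z) \<le> \<beta> / 2 + (1/2 - S z) * r z"
        using \<beta> \<epsilon> S rR r_gt[OF z1] by (intro slow_drift_lower) (auto simp: R_def)
      moreover have "\<epsilon>/2 * \<beta> / 2 \<le> \<beta> * S z"
        using \<beta> \<epsilon> S mult_left_mono[of "\<epsilon>/4" "S z" \<beta>] by (simp add: mult_ac)
      ultimately have b: "\<epsilon> * \<beta> / 4 \<le> \<beta> / 2 + (1/2 - S z) * r z" by simp
      then have "z\<^sup>2 * (\<epsilon> * \<beta> / 4) \<le> z\<^sup>2 * (\<beta> / 2 + (1/2 - S z) * r z)"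
        by (intro mult_left_mono) auto
      from r_deriv_ge[OF z1 rR _ this] R
      have r': "(z\<^sup>2 * (\<epsilon> * \<beta> / 4) - M) / z \<le> ?r' z" by (simp add: M_def diff_diff_eq)
      have "S z * (- 2 * \<beta>) \<le> S z * (r z - \<beta>)"
        using r_gt[OF z1] S by (intro mult_left_mono) auto
      moreover have "S z * \<beta> \<le> 1 * \<beta>" using S \<epsilon> \<beta> by (intro mult_right_mono) auto
      ultimately have "- 2 * \<beta> \<le> S z * (r z - \<beta>)" by (simp add: algebra_simps)
      then have "- 2 * \<beta> / (\<beta> * z) \<le> ?S' z" using \<beta> z1 by (intro divide_right_mono) auto
      then have S': "- 2 / z \<le> ?S' z" using \<beta> by simp
      have "(3 + \<kappa> * M) / (\<kappa> * (\<epsilon> * \<beta> / 4)) \<le> z" using z y0 by (simp add: Y_def)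
      then have "3 + \<kappa> * M \<le> z * (\<kappa> * (\<epsilon> * \<beta> / 4))" using \<kappa> \<beta> \<epsilon> by (simp add: pos_divide_le_eq)
      also have "\<dots> \<le> z\<^sup>2 * (\<kappa> * (\<epsilon> * \<beta> / 4))"
        using \<kappa> \<beta> \<epsilon> z1 by (intro mult_right_mono) (auto simp: power2_eq_square)
      finally have "0 < (- 2 + \<kappa> * (z\<^sup>2 * (\<epsilon> * \<beta> / 4) - M)) / z"
        using z1 by (intro divide_pos_pos) (auto simp: algebra_simps)
      also have "\<dots> = - 2 / z + \<kappa> * ((z\<^sup>2 * (\<epsilon> * \<beta> / 4) - M) / z)"
        by (simp only: add_divide_distrib times_divide_eq_right)
      also have "\<dots> \<le> ?S' z + \<kappa> * ?r' z"
        using S' r' \<kappa> by (intro add_mono mult_left_mono) auto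
      finally show "?S' z + \<kappa> * ?r' z > 0" .
    qed (use y y0 \<epsilon> in auto)
    then show "S y > 1 - \<epsilon>" by simp
  qed
qed

section \<open>Boundedness of \<open>r\<close> and upper trapping of \<open>S\<close>\<close>

lemma r_bounded:
  assumes Y: "Y \<ge> 1" and S: "\<And>y. y \<ge> Y \<Longrightarrow> S y \<ge> 3/4"
  obtains C where "C > 0" "\<And>y. y \<ge> Y \<Longrightarrow> r y < C"
proof -
  \<comment> \<open>At \<open>r = C\<close>, \<open>C > 2 * \<beta>\<close> makes the drift negative
    when \<open>S \<ge> 3/4\<close>, and \<open>C \<ge> 1\<close> makes
    \<open>r - r\<^sup>2 \<le> 0\<close>. The term \<open>r Y + 1\<close> puts the start below the
    barrier.\<close>
  define C where "C = max (r Y + 1) (2 * \<beta> + 1)"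
  have C: "C \<ge> 2 * \<beta> + 1" "C > r Y" by (auto simp: C_def)
  have "C - r y > 0" if "y \<ge> Y" for y
  proof (rule trapped_positive[of Y "\<lambda>y. C - r y"])
    fix z assume z: "z > Y" "C - r z = 0"
    have "C * 1 \<le> C * C" using C \<beta> by (intro mult_left_mono) auto
    then have "(r z - (r z)\<^sup>2) / z \<le> 0"
      using z Y by (intro divide_nonpos_pos) (auto simp: power2_eq_square)
    moreover have "(1/4) * C \<le> (S z - 1/2) * r z"
      using S[of z] z C \<beta> by (intro mult_mono) auto
    then have "\<beta> / 2 + (1/2 - S z) * r z < 0" using C by (simp add: algebra_simps)
    then have "z * (\<beta> / 2 + (1/2 - S z) * r z) < 0" using z Y by (simp add: mult_less_0_iff)
    ultimately show "0 - ((r z - (r z)\<^sup>2) / z + z * (\<beta> / 2 + (1/2 - S z) * r z)) > 0" by linarith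
  next
    fix z assume z: "z \<ge> Y"
    show "((\<lambda>y. C - r y) has_real_derivative
         0 - ((r z - (r z)\<^sup>2) / z + z * (\<beta> / 2 + (1/2 - S z) * r z))) (at z)"
      using z Y by (intro DERIV_diff Dr DERIV_const) auto
  qed (use that C in auto)
  then show ?thesis using C \<beta> by (intro that[of C]) force+
qed

text \<open>Mirror image of \<open>S_frequently_ge\<close>: if \<open>S > 1 + \<epsilon>\<close>
  persisted, \<open>r\<close> would drop below \<open>R\<close> and stay below
  \<open>\<beta> * (1 - \<epsilon>/4)\<close>, and \<open>S\<close> would fall below 1.\<close>

lemma S_frequently_le:
  assumes \<epsilon>: "0 < \<epsilon>" "\<epsilon> \<le> 1/2" and Y: "Y \<ge> 1"
  shows "\<exists>y\<ge>Y. S y \<le> 1 + \<epsilon>"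
proof (rule ccontr)
  assume "\<not> ?thesis"
  then have S: "S y > 1 + \<epsilon>" if "y \<ge> Y" for y using that by force
  define R where "R = \<beta> * (1 - \<epsilon>/2)"
  have R: "\<beta> * \<epsilon> > 0" using \<beta> \<epsilon> by simp
  \<comment> \<open>From here on \<open>y\<^sup>2 * (\<epsilon> * \<beta> / 2) \<ge> 2\<close>,
    which turns \<open>r_deriv_le\<close> into \<open>r' \<le> - 1 / y\<close>.\<close>
  define Y1 where "Y1 = max Y (4 / (\<epsilon> * \<beta>))"
  have Y1: "Y1 \<ge> Y" "Y1 \<ge> 1" using Y by (auto simp: Y1_def)
  have r': "(r y - (r y)\<^sup>2) / y + y * (\<beta> / 2 + (1/2 - S y) * r y) \<le> - 1 / y"
    if y: "y \<ge> Y1" and r: "r y \<ge> R" for y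
  proof -
    have y1: "y \<ge> 1" "y \<ge> Y" using y Y1 by auto
    have "\<beta> / 2 + (1/2 - S y) * r y \<le> - (\<epsilon> * \<beta> / 2)"
      using S[OF y1(2)] r by (intro slow_drift_upper \<beta> \<epsilon>) (auto simp: R_def)
    from r_deriv_le[OF y1(1) this]
    have "(r y - (r y)\<^sup>2) / y + y * (\<beta> / 2 + (1/2 - S y) * r y) \<le> (1 - y\<^sup>2 * (\<epsilon> * \<beta> / 2)) / y" .
    also have "\<dots> \<le> - 1 / y"
    proof -
      have "4 / (\<epsilon> * \<beta>) \<le> y" using y by (simp add: Y1_def)
      then have "2 \<le> y * (\<epsilon> * \<beta> / 2)" using \<epsilon> \<beta> by (simp add: field_simps)
      also have "\<dots> \<le> y\<^sup>2 * (\<epsilon> * \<beta> / 2)"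
        using \<beta> \<epsilon> y1 by (intro mult_right_mono) (auto simp: power2_eq_square)
      finally show ?thesis using y1 by (intro divide_right_mono) auto
    qed
    finally show ?thesis .
  qed
  have "\<exists>y0\<ge>Y1. r y0 < R"
  proof (rule ccontr)
    assume "\<not> ?thesis"
    then have r: "r y \<ge> R" if "y \<ge> Y1" for y using that by force
    moreover have "\<exists>y\<ge>Y1. - r y > - R"
      by (intro unbounded_if_deriv_ge_inverse[OF DERIV_minus[OF Dr], of Y1 1]) (use r r' Y1 in \<open>force+\<close>)
    ultimately show False by force
  qed
  then obtain y0 where y0: "y0 \<ge> Y1" "r y0 < R" by blast
  have r_small: "r y < R + \<beta> * \<epsilon> / 4" if "y \<ge> y0" for y
  proof -
    have "(R + \<beta> * \<epsilon> / 4) - r y > 0"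
    proof (rule trapped_positive[of y0 "\<lambda>y. (R + \<beta> * \<epsilon> / 4) - r y"])
      fix z assume z: "z > y0" "(R + \<beta> * \<epsilon> / 4) - r z = 0"
      have "(r z - (r z)\<^sup>2) / z + z * (\<beta> / 2 + (1/2 - S z) * r z) \<le> - 1 / z"
        using z y0 R by (intro r') auto
      also have "- 1 / z < 0" using z y0 Y1 by simp
      finally show "0 < 0 - ((r z - (r z)\<^sup>2) / z + z * (\<beta> / 2 + (1/2 - S z) * r z))" by simp
    next
      fix z assume z: "z \<ge> y0"
      show "((\<lambda>y. (R + \<beta> * \<epsilon> / 4) - r y) has_real_derivative
           0 - ((r z - (r z)\<^sup>2) / z + z * (\<beta> / 2 + (1/2 - S z) * r z))) (at z)"
        using z y0 Y1 by (intro DERIV_diff Dr DERIV_const) auto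
    qed (use that y0 R in auto)
    then show ?thesis by simp
  qed
  have "\<exists>y\<ge>y0. - ln (S y) > 0"
  proof (rule unbounded_if_deriv_ge_inverse[OF DERIV_minus[OF D_ln_S], of y0 "\<epsilon> / 4"])
    fix y assume y: "y \<ge> y0"
    have "\<epsilon> / 4 * \<beta> \<le> \<beta> - r y" using r_small[OF y] by (simp add: R_def algebra_simps)
    then have "\<epsilon> / 4 * \<beta> / (\<beta> * y) \<le> (\<beta> - r y) / (\<beta> * y)"
      using \<beta> y y0 Y1 by (intro divide_right_mono) auto
    moreover have "- ((r y - \<beta>) / (\<beta> * y)) = (\<beta> - r y) / (\<beta> * y)"
      by (metis minus_diff_eq minus_divide_left)
    ultimately show "\<epsilon> / 4 / y \<le> - ((r y - \<beta>) / (\<beta> * y))"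
      using \<beta> by simp
  qed (use y0 Y1 \<epsilon> in auto)
  then obtain y where y: "y \<ge> y0" "ln (S y) < 0" by auto
  then have "S y < 1" using S_pos[of y] y0 Y1 by simp
  then show False using S[of y] y y0 Y1 \<epsilon> by simp
qed

text \<open>The trapping region is reflected, with the corner cut by the line
  \<open>S = 1 + \<epsilon> - \<kappa> * (r - R)\<close>. The cut is on the side of large
  \<open>r\<close>, so the bound \<open>C\<close> takes the role that \<open>r > - \<beta>\<close>
  has in the lower trapping.\<close>

lemma S_eventually_trapped_above:
  assumes \<epsilon>: "0 < \<epsilon>" "\<epsilon> \<le> 1/2" and C: "C > 0" and Y0: "Y0 \<ge> 1" "\<And>y. y \<ge> Y0 \<Longrightarrow> r y < C"
  shows "\<exists>Y\<ge>1. \<forall>y0\<ge>Y. S y0 \<le> 1 + \<epsilon>/2 \<longrightarrow> (\<forall>y\<ge>y0. S y < 1 + \<epsilon>)"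
proof -
  \<comment> \<open>Since \<open>R > 0\<close> and \<open>r < C\<close>,
    \<open>\<kappa> * (r - R)\<close> stays below \<open>\<kappa> * C = \<epsilon> / 4\<close>,
    which leaves room for a start with \<open>S \<le> 1 + \<epsilon>/2\<close>.\<close>
  define \<kappa> where "\<kappa> = \<epsilon> / (4 * C)"
  define R where "R = \<beta> * (1 - \<epsilon>/4)"
  have R: "R > 0" using \<beta> \<epsilon> by (auto simp: R_def)
  have \<kappa>: "\<kappa> > 0" "\<kappa> * C < \<epsilon> / 2" using C \<epsilon> by (auto simp: \<kappa>_def field_simps)
  define M where "M = 2 * C / \<beta>"
  \<comment> \<open>Beyond \<open>Y\<close> the inward drift beats \<open>\<kappa> + M\<close>:
    \<open>M / z\<close> bounds \<open>S'\<close>, and \<open>\<kappa>\<close> comes from the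
    \<open>1\<close> in \<open>r_deriv_le\<close>.\<close>
  define Y where "Y = Y0 + (1 + \<kappa> + M) / (\<kappa> * (\<epsilon> * \<beta> / 4))"
  have M: "M > 0" using \<beta> C by (simp add: M_def)
  have Y: "Y \<ge> Y0" using \<beta> \<epsilon> \<kappa> M by (simp add: Y_def)
  show ?thesis
  proof (intro exI[of _ Y] conjI allI impI)
    show "Y \<ge> 1" using Y Y0 by simp
    fix y0 y :: real assume y0: "Y \<le> y0" "S y0 \<le> 1 + \<epsilon> / 2" and y: "y0 \<le> y"
    have ge1: "z \<ge> 1" "z \<ge> Y0" if "z \<ge> y0" for z using that y0 Y Y0 by linarith+
    let ?S' = "\<lambda>z. S z * (r z - \<beta>) / (\<beta> * z)"
    let ?r' = "\<lambda>z. (r z - (r z)\<^sup>2) / z + z * (\<beta> / 2 + (1/2 - S z) * r z)"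
    have \<kappa>r: "\<kappa> * (r z - R) < \<epsilon> / 2" if "z \<ge> y0" for z
      using \<kappa> R Y0(2)[OF ge1(2)[OF that]] by (intro le_less_trans[OF _ \<kappa>(2)] mult_left_mono) auto
    have "1 + \<epsilon> - S y > 0 \<and> 1 + \<epsilon> - S y - \<kappa> * (r y - R) > 0"
    proof (rule trapped_positive_pair[of y0 "\<lambda>z. 1 + \<epsilon> - S z" "\<lambda>z. - ?S' z"
        "\<lambda>z. 1 + \<epsilon> - S z - \<kappa> * (r z - R)" "\<lambda>z. - ?S' z - \<kappa> * ?r' z"])
      show "((\<lambda>z. 1 + \<epsilon> - S z) has_real_derivative - ?S' z) (at z)" if "z \<ge> y0" for z
        using ge1[OF that] by (auto intro!: derivative_eq_intros DS)
      show "((\<lambda>z. 1 + \<epsilon> - S z - \<kappa> * (r z - R)) has_real_derivative - ?S' z - \<kappa> * ?r' z) (at z)"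
        if "z \<ge> y0" for z
        using ge1[OF that] by (auto intro!: derivative_eq_intros DS Dr simp: algebra_simps)
      show "1 + \<epsilon> - S y0 - \<kappa> * (r y0 - R) > 0" using y0 \<kappa>r[of y0] by simp
    next
      fix z assume z: "z > y0" "1 + \<epsilon> - S z = 0" "0 \<le> 1 + \<epsilon> - S z - \<kappa> * (r z - R)"
      then have "r z \<le> R" using \<kappa> by (simp add: zero_le_mult_iff mult_le_0_iff)
      also have "R < \<beta>" using \<beta> \<epsilon> by (simp add: R_def)
      finally have "S z * (r z - \<beta>) < 0" using S_pos[of z] ge1[of z] z by (simp add: mult_less_0_iff)
      then have "?S' z < 0" using \<beta> ge1[of z] z by (intro divide_neg_pos) auto
      then show "- ?S' z > 0" by simp
    next
      fix z assume z: "z > y0" "1 + \<epsilon> - S z - \<kappa> * (r z - R) = 0" "0 \<le> 1 + \<epsilon> - S z"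
      have z1: "z \<ge> 1" "r z < C" using z ge1[of z] Y0(2) by auto
      have "\<kappa> * (r z - R) \<ge> 0" using z by linarith
      then have rR: "r z \<ge> R" using \<kappa> by (simp add: zero_le_mult_iff)
      have S: "S z \<ge> 1 + \<epsilon>/2" "S z \<le> 2" using \<kappa>r[of z] z \<epsilon> by auto
      have "\<beta> / 2 + (1/2 - S z) * r z \<le> - (\<epsilon>/2 * \<beta> / 2)"
        using \<beta> \<epsilon> S rR by (intro slow_drift_upper) (auto simp: R_def)
      from r_deriv_le[OF z1(1) this]
      have r': "?r' z \<le> (1 - z\<^sup>2 * (\<epsilon> * \<beta> / 4)) / z" by simp
      have "S z * (r z - \<beta>) \<le> S z * C" using z1 \<beta> S \<epsilon> by (intro mult_left_mono) auto
      also have "\<dots> \<le> 2 * C" using S C by (intro mult_right_mono) auto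
      finally have "?S' z \<le> 2 * C / (\<beta> * z)" using \<beta> z1 by (intro divide_right_mono) auto
      then have S': "?S' z \<le> M / z" by (simp add: M_def)
      have "(1 + \<kappa> + M) / (\<kappa> * (\<epsilon> * \<beta> / 4)) \<le> z" using z y0 Y0 by (simp add: Y_def)
      then have "1 + \<kappa> + M \<le> z * (\<kappa> * (\<epsilon> * \<beta> / 4))" using \<kappa> \<beta> \<epsilon> by (simp add: pos_divide_le_eq)
      also have "\<dots> \<le> z\<^sup>2 * (\<kappa> * (\<epsilon> * \<beta> / 4))"
        using \<kappa> \<beta> \<epsilon> z1 by (intro mult_right_mono) (auto simp: power2_eq_square)
      finally have "(M + \<kappa> * (1 - z\<^sup>2 * (\<epsilon> * \<beta> / 4))) / z < 0"
        using z1 by (intro divide_neg_pos) (auto simp: algebra_simps)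
      moreover have "(M + \<kappa> * (1 - z\<^sup>2 * (\<epsilon> * \<beta> / 4))) / z = M / z + \<kappa> * ((1 - z\<^sup>2 * (\<epsilon> * \<beta> / 4)) / z)"
        by (simp only: add_divide_distrib times_divide_eq_right)
      moreover have "?S' z + \<kappa> * ?r' z \<le> M / z + \<kappa> * ((1 - z\<^sup>2 * (\<epsilon> * \<beta> / 4)) / z)"
        using S' r' \<kappa> by (intro add_mono mult_left_mono) auto
      ultimately show "- ?S' z - \<kappa> * ?r' z > 0" by linarith
    qed (use y y0 \<epsilon> in auto)
    then show "S y < 1 + \<epsilon>" by simp
  qed
qed

text \<open>\<open>S_frequently_ge\<close> with \<open>\<epsilon>/2\<close> supplies a starting
  point beyond the threshold of the lower trapping.\<close>

lemma S_eventually_gt: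
  assumes \<epsilon>: "0 < \<epsilon>" "\<epsilon> \<le> 1/2"
  obtains Y where "Y \<ge> 1" "\<And>y. y \<ge> Y \<Longrightarrow> S y > 1 - \<epsilon>"
proof -
  obtain Y where Y: "Y \<ge> 1" "\<And>y0 y. y0 \<ge> Y \<Longrightarrow> S y0 \<ge> 1 - \<epsilon>/2 \<Longrightarrow> y \<ge> y0 \<Longrightarrow> S y > 1 - \<epsilon>"
    using S_eventually_trapped_below[OF \<epsilon>] by blast
  obtain y0 where "y0 \<ge> Y" "S y0 \<ge> 1 - \<epsilon>/2"
    using S_frequently_ge[of "\<epsilon>/2" Y] Y \<epsilon> by auto
  then show thesis using Y by (intro that[of y0]) auto
qed

text \<open>The lower bound comes first: tolerance \<open>1/4\<close> gives \<open>S > 3/4\<close>,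
  hence an upper bound for \<open>r\<close>, and with it the upper trapping.\<close>

lemma S_tendsto: "(S \<longlongrightarrow> 1) at_top"
proof (rule tendstoI)
  fix e :: real assume "e > 0"
  define \<epsilon> where "\<epsilon> = min e (1/2)"
  have \<epsilon>: "0 < \<epsilon>" "\<epsilon> \<le> 1/2" "\<epsilon> \<le> e" using \<open>e > 0\<close> by (auto simp: \<epsilon>_def)
  obtain Y1 where Y1: "Y1 \<ge> 1" "\<And>y. y \<ge> Y1 \<Longrightarrow> S y > 1 - 1/4" using S_eventually_gt[of "1/4"] by auto
  have "S y \<ge> 3/4" if "y \<ge> Y1" for y using Y1(2)[OF that] by simp
  then obtain C where C: "C > 0" "\<And>y. y \<ge> Y1 \<Longrightarrow> r y < C"
    using r_bounded[OF Y1(1)] by metis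
  obtain Y2 where Y2: "Y2 \<ge> 1" "\<And>y. y \<ge> Y2 \<Longrightarrow> S y > 1 - \<epsilon>" using S_eventually_gt[OF \<epsilon>(1,2)] by blast
  obtain Y3 where Y3: "Y3 \<ge> 1" "\<And>y0 y. y0 \<ge> Y3 \<Longrightarrow> S y0 \<le> 1 + \<epsilon>/2 \<Longrightarrow> y \<ge> y0 \<Longrightarrow> S y < 1 + \<epsilon>"
    using S_eventually_trapped_above[OF \<epsilon>(1,2) C(1) Y1(1) C(2)] by blast
  obtain y0 where y0: "y0 \<ge> Y3" "S y0 \<le> 1 + \<epsilon>/2"
    using S_frequently_le[of "\<epsilon>/2" Y3] Y3 \<epsilon> by auto
  show "\<forall>\<^sub>F y in at_top. dist (S y) 1 < e"
    using eventually_ge_at_top[of "max Y2 y0"]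
  proof eventually_elim
    case (elim y)
    then show ?case using Y2(2)[of y] Y3(2)[OF y0, of y] \<epsilon> by (auto simp: dist_real_def)
  qed
qed

end

section \<open>The self-similar profile\<close>

lemma powr_lipschitz:
  fixes a b B p :: real
  assumes "0 < a" "a \<le> B" "0 < b" "b \<le> B" "p \<ge> 1"
  shows "\<bar>a powr p - b powr p\<bar> \<le> p * B powr (p - 1) * \<bar>a - b\<bar>"
proof -
  have "norm (a powr p - b powr p) \<le> p * B powr (p - 1) * norm (a - b)"
  proof (rule field_differentiable_bound[of "{0<..B}"])
    show "((\<lambda>x. x powr p) has_real_derivative p * x powr (p - 1)) (at x within {0<..B})"
      if "x \<in> {0<..B}" for x
      using that by (simp add: has_real_derivative_powr has_field_derivative_at_within)
    show "norm (p * x powr (p - 1)) \<le> p * B powr (p - 1)" if "x \<in> {0<..B}" for x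
      using that assms powr_mono2[of "p - 1" x B] by (simp add: abs_mult mult_left_mono)
  qed (use assms in auto)
  then show ?thesis by simp
qed

lemma at_within_atLeast_interior: "a < y \<Longrightarrow> at y within {a..} = at (y::real)"
  by (rule at_within_interior) (simp add: interior_real_atLeast)

lemma mono_if_deriv_nonneg_atLeast:
  fixes f :: "real \<Rightarrow> real"
  assumes D: "\<And>y. y \<ge> 0 \<Longrightarrow> (f has_real_derivative f' y) (at y within {0..})"
    and nonneg: "\<And>y. 0 < y \<Longrightarrow> y < b \<Longrightarrow> f' y \<ge> 0" and "0 \<le> a" "a \<le> b"
  shows "f a \<le> f b"
proof (rule DERIV_nonneg_imp_increasing_open[OF \<open>a \<le> b\<close>])
  have "continuous_on {0..} f"
    using D by (auto simp: continuous_on_eq_continuous_within intro: DERIV_continuous)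
  then show "continuous_on {a..b} f" by (rule continuous_on_subset) (use assms in auto)
  fix x assume "a < x" "x < b"
  then show "\<exists>y. (f has_real_derivative y) (at x) \<and> 0 \<le> y"
    using D[of x] nonneg[of x] \<open>0 \<le> a\<close> by (auto simp: at_within_atLeast_interior)
qed

section \<open>The truncated initial value problem for the profile\<close>

locale profile_constants =
  fixes p \<beta> \<gamma> :: real
  assumes p: "p > 1" and \<beta>_def: "\<beta> = 1 / (p - 1)" and \<gamma>_def: "\<gamma> = (1 - \<beta>) / 2"
begin

lemma \<beta>_pos: "\<beta> > 0" and \<beta>_mult: "(p - 1) * \<beta> = 1" and p_mult: "p * \<beta> = \<beta> + 1"
  using p by (auto simp: \<beta>_def field_simps)

text \<open>Turns \<open>(v + y * v') / 2 - \<gamma> * v\<close>, the derivative of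
  \<open>E\<close>, into half of \<open>\<beta> * v + y * v'\<close>.\<close>

lemma \<gamma>_mult: "\<gamma> * x = x / 2 - \<beta> * x / 2"
  by (simp add: \<gamma>_def field_simps)

text \<open>
  The nonlinearity is truncated between a solution of \<open>l' = - l\<^sup>p\<close> and a Gaussian; this makes the system
  globally Lipschitz in the unknowns, and the solution turns out never to touch the truncation.
\<close>
definition lower :: "real \<Rightarrow> real" where "lower y = (2 + (p - 1) * y) powr - \<beta>"
definition upper :: "real \<Rightarrow> real" where "upper y = 2 * exp ((1/2 + \<bar>\<gamma>\<bar>) * y\<^sup>2)"
definition clamp :: "real \<Rightarrow> real \<Rightarrow> real" where "clamp y v = max (lower y) (min (upper y) v)"

lemma base_pos: "y \<ge> 0 \<Longrightarrow> 2 + (p - 1) * y > 0"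
  using p by (intro add_pos_nonneg) auto

lemma lower_pos: "y \<ge> 0 \<Longrightarrow> lower y > 0"
  using base_pos[of y] by (simp add: lower_def)

lemma lower_le_1:
  assumes "y \<ge> 0" shows "lower y \<le> 1"
proof -
  have "(p - 1) * y \<ge> 0" using p assms by simp
  then show ?thesis using \<beta>_pos powr_mono[of "- \<beta>" 0 "2 + (p - 1) * y"] by (simp add: lower_def)
qed

lemma upper_ge_2: "upper y \<ge> 2"
  by (simp add: upper_def)

lemma upper_mono: "0 \<le> x \<Longrightarrow> x \<le> y \<Longrightarrow> upper x \<le> upper y"
  by (auto simp: upper_def intro!: mult_left_mono power_mono)

lemma clamp_bounds: "y \<ge> 0 \<Longrightarrow> lower y \<le> clamp y v \<and> clamp y v \<le> upper y \<and> clamp y v > 0"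
  using lower_pos[of y] lower_le_1[of y] upper_ge_2[of y] by (auto simp: clamp_def)

lemma clamp_nonzero: "y \<ge> 0 \<Longrightarrow> clamp y v \<noteq> 0"
  using clamp_bounds[of y v] by linarith

lemma clamp_lipschitz: "\<bar>clamp y v - clamp y v'\<bar> \<le> \<bar>v - v'\<bar>"
  by (auto simp: clamp_def max_def min_def)

text \<open>The chain rule factor \<open>- \<beta> * (p - 1)\<close> is \<open>-1\<close>, and the
  new exponent \<open>- \<beta> - 1\<close> is \<open>- (p * \<beta>)\<close>.\<close>

lemma D_lower:
  assumes "y \<ge> 0"
  shows "(lower has_real_derivative - (lower y powr p)) (at y within X)"
proof -
  have "(lower has_real_derivative - \<beta> * (2 + (p - 1) * y) powr (- \<beta> - 1) * (p - 1)) (at y within X)"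
    unfolding lower_def using base_pos[OF assms]
    by (auto intro!: derivative_eq_intros simp: field_simps powr_diff)
  moreover have "- \<beta> * x * (p - 1) = - x" for x
  proof -
    have "- \<beta> * x * (p - 1) = - ((p - 1) * \<beta>) * x" by (simp add: algebra_simps)
    then show ?thesis by (simp add: \<beta>_mult)
  qed
  moreover have "(2 + (p - 1) * y) powr (- \<beta> - 1) = lower y powr p"
    using p_mult by (simp add: lower_def powr_powr mult.commute)
  ultimately show ?thesis by metis
qed

lemma D_upper: "(upper has_real_derivative (1 + 2 * \<bar>\<gamma>\<bar>) * y * upper y) (at y within X)"
  unfolding upper_def by (auto intro!: derivative_eq_intros simp: field_simps)

lemma continuous_clamp:
  assumes "continuous_on {0..} v"
  shows "continuous_on {0..} (\<lambda>y. clamp y (v y))"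
proof -
  have "continuous_on {0..} lower" "continuous_on {0..} upper"
    by (auto simp: continuous_on_eq_continuous_within
        intro!: DERIV_continuous[OF D_lower] DERIV_continuous[OF D_upper])
  then show ?thesis unfolding clamp_def by (intro continuous_intros assms)
qed

text \<open>On \<open>{0..T}\<close> the clamped value stays in \<open>{0<..upper T}\<close>, where
  the power is Lipschitz, so the global existence lemma applies.\<close>

lemma truncated_solution:
  obtains \<phi> v where "\<phi> 0 = 0" "v 0 = 1"
    "\<And>y. y \<ge> 0 \<Longrightarrow> (\<phi> has_real_derivative clamp y (v y)) (at y within {0..})"
    "\<And>y. y \<ge> 0 \<Longrightarrow> (v has_real_derivative
       y * clamp y (v y) / 2 - \<gamma> * \<phi> y - clamp y (v y) powr p) (at y within {0..})"
proof -
  define f :: "real \<Rightarrow> real \<times> real \<Rightarrow> real \<times> real" where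
    "f y x = (clamp y (snd x), y * clamp y (snd x) / 2 - \<gamma> * fst x - clamp y (snd x) powr p)" for y x
  obtain x where x: "x 0 = (0, 1)"
    "\<And>t. t \<ge> 0 \<Longrightarrow> (x has_vector_derivative f t (x t)) (at t within {0..})"
  proof (rule global_picard_lindelof[of f "(0, 1)"])
    fix x :: "real \<Rightarrow> real \<times> real" assume c: "continuous_on {0..} x"
    have [continuous_intros]: "continuous_on {0..} (\<lambda>y. clamp y (snd (x y)))"
      by (intro continuous_clamp continuous_intros c)
    show "continuous_on {0..} (\<lambda>t. f t (x t))"
      unfolding f_def by (intro continuous_intros c) (auto simp: clamp_nonzero)
  next
    fix T :: real assume T: "T \<ge> 0"
    \<comment> \<open>One summand for each dependence on the unknowns: the clamped value itself, the
      two linear terms, and the power.\<close>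
    define L where "L = 1 + T / 2 + \<bar>\<gamma>\<bar> + p * upper T powr (p - 1)"
    show "\<exists>L\<ge>0. \<forall>t\<in>{0..T}. \<forall>x y. norm (f t x - f t y) \<le> L * norm (x - y)"
    proof (intro exI[of _ L] conjI ballI allI)
      show "L \<ge> 0" using T p by (simp add: L_def)
      fix t :: real and x y :: "real \<times> real" assume t: "t \<in> {0..T}"
      define a where "a = clamp t (snd x)"
      define b where "b = clamp t (snd y)"
      define d where "d = norm (x - y)"
      have ab: "0 < a" "a \<le> upper T" "0 < b" "b \<le> upper T"
        using clamp_bounds[of t] upper_mono[of t T] t by (force simp: a_def b_def intro: order_trans)+
      have "\<bar>snd x - snd y\<bar> \<le> d" "\<bar>fst x - fst y\<bar> \<le> d"
        using norm_snd_le[of "snd x - snd y" "fst x - fst y"] norm_fst_le[of "fst x - fst y" "snd x - snd y"]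
        by (simp_all add: d_def minus_prod_def)
      then have d: "\<bar>a - b\<bar> \<le> d" "\<bar>fst x - fst y\<bar> \<le> d"
        using clamp_lipschitz[of t "snd x" "snd y"] by (auto simp: a_def b_def)
      have "\<bar>a powr p - b powr p\<bar> \<le> p * upper T powr (p - 1) * d"
        using p d by (intro order_trans[OF powr_lipschitz[OF ab]] mult_left_mono) auto
      moreover have "\<bar>t * (a - b) / 2\<bar> \<le> T / 2 * d"
      proof -
        have "\<bar>t * (a - b) / 2\<bar> = t / 2 * \<bar>a - b\<bar>" using t by (simp add: abs_mult)
        also have "\<dots> \<le> T / 2 * d" using t d by (intro mult_mono) auto
        finally show ?thesis .
      qed
      moreover have "\<bar>\<gamma> * (fst x - fst y)\<bar> \<le> \<bar>\<gamma>\<bar> * d"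
        using d by (simp add: abs_mult mult_left_mono)
      moreover have "f t x - f t y = (a - b, t * (a - b) / 2 - \<gamma> * (fst x - fst y) - (a powr p - b powr p))"
        by (simp add: f_def a_def b_def algebra_simps diff_divide_distrib)
      then have "norm (f t x - f t y) \<le> \<bar>a - b\<bar> + \<bar>t * (a - b) / 2 - \<gamma> * (fst x - fst y) - (a powr p - b powr p)\<bar>"
        by (metis norm_Pair_le real_norm_def)
      ultimately have "norm (f t x - f t y) \<le> d + (T / 2 * d + \<bar>\<gamma>\<bar> * d + p * upper T powr (p - 1) * d)"
        using d(1) by linarith
      also have "\<dots> = L * d" by (simp add: L_def algebra_simps)
      finally show "norm (f t x - f t y) \<le> L * norm (x - y)" by (simp add: d_def)
    qed
  qed blast
  show thesis
  proof (rule that[of "\<lambda>y. fst (x y)" "\<lambda>y. snd (x y)"])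
    fix y :: real assume y: "y \<ge> 0"
    show "((\<lambda>y. fst (x y)) has_real_derivative clamp y (snd (x y))) (at y within {0..})"
      using bounded_linear.has_vector_derivative[OF bounded_linear_fst x(2)[OF y]]
      by (simp add: f_def has_real_derivative_iff_has_vector_derivative)
    show "((\<lambda>y. snd (x y)) has_real_derivative
       y * clamp y (snd (x y)) / 2 - \<gamma> * fst (x y) - clamp y (snd (x y)) powr p) (at y within {0..})"
      using bounded_linear.has_vector_derivative[OF bounded_linear_snd x(2)[OF y]]
      by (simp add: f_def has_real_derivative_iff_has_vector_derivative)
  qed (simp_all add: x)
qed

text \<open>The clamped value is at most \<open>upper\<close>, so
  \<open>0 \<le> \<phi> \<le> y * upper\<close> and
  \<open>v' \<le> (1/2 + \<bar>\<gamma>\<bar>) * y * upper\<close>, half the derivative of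
  \<open>upper\<close>. Hence \<open>upper - v\<close> does not decrease from its initial value
  \<open>2 - 1\<close>.\<close>

lemma truncated_lt_upper:
  assumes \<phi>0: "\<phi> 0 = 0" and v0: "v 0 = 1"
    and D\<phi>: "\<And>y. y \<ge> 0 \<Longrightarrow> (\<phi> has_real_derivative clamp y (v y)) (at y within {0..})"
    and Dv: "\<And>y. y \<ge> 0 \<Longrightarrow> (v has_real_derivative
       y * clamp y (v y) / 2 - \<gamma> * \<phi> y - clamp y (v y) powr p) (at y within {0..})"
    and y: "y \<ge> 0"
  shows "v y < upper y"
proof -
  have \<phi>_ge: "\<phi> y \<ge> 0" if "y \<ge> 0" for y
    using mono_if_deriv_nonneg_atLeast[OF D\<phi>, of y 0] clamp_bounds that \<phi>0 by (fastforce simp: less_imp_le)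
  have \<phi>_le: "\<phi> y \<le> y * upper y" if "y \<ge> 0" for y
  proof -
    have "0 * upper 0 - \<phi> 0 \<le> y * upper y - \<phi> y"
    proof (rule mono_if_deriv_nonneg_atLeast[of "\<lambda>y. y * upper y - \<phi> y"])
      fix z :: real assume z: "0 < z"
      have "z * ((1 + 2 * \<bar>\<gamma>\<bar>) * z * upper z) \<ge> 0"
        using z upper_ge_2[of z] by (intro mult_nonneg_nonneg) auto
      then show "upper z + z * ((1 + 2 * \<bar>\<gamma>\<bar>) * z * upper z) - clamp z (v z) \<ge> 0"
        using clamp_bounds[of z "v z"] z by linarith
    qed (auto intro!: derivative_eq_intros D_upper D\<phi> simp: that)
    then show ?thesis using \<phi>0 by simp
  qed
  have "upper 0 - v 0 \<le> upper y - v y"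
  proof (rule mono_if_deriv_nonneg_atLeast[of "\<lambda>y. upper y - v y"])
    fix z :: real assume z: "0 < z"
    have w: "0 < clamp z (v z)" "clamp z (v z) \<le> upper z" using z clamp_bounds[of z "v z"] by auto
    have "z * clamp z (v z) / 2 \<le> z * upper z / 2" using z w by simp
    moreover have "- \<gamma> * \<phi> z \<le> \<bar>\<gamma>\<bar> * (z * upper z)"
      using \<phi>_ge[of z] \<phi>_le[of z] z by (intro mult_mono) auto
    moreover have "clamp z (v z) powr p \<ge> 0" by simp
    moreover have "\<bar>\<gamma>\<bar> * (z * upper z) \<ge> 0" "z * upper z / 2 \<ge> 0" using z upper_ge_2[of z] by auto
    moreover have "(1 + 2 * \<bar>\<gamma>\<bar>) * z * upper z = 2 * (z * upper z / 2) + 2 * (\<bar>\<gamma>\<bar> * (z * upper z))"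
      by (simp add: algebra_simps)
    ultimately show "(1 + 2 * \<bar>\<gamma>\<bar>) * z * upper z
        - (z * clamp z (v z) / 2 - \<gamma> * \<phi> z - clamp z (v z) powr p) \<ge> 0"
      by linarith
  qed (use y in \<open>auto intro!: derivative_eq_intros D_upper Dv\<close>)
  then show ?thesis using v0 upper_ge_2[of 0] by simp
qed

text \<open>The two bounds are carried together: \<open>v > lower\<close> identifies the clamped
  value with \<open>v\<close>, which gives \<open>E' = h / 2\<close>; \<open>h > 0\<close> makes
  \<open>E\<close> positive; and \<open>E > 0\<close> keeps \<open>v\<close> above
  \<open>lower\<close>.\<close>

lemma truncated_stays_above:
  assumes \<phi>0: "\<phi> 0 = 0" and v0: "v 0 = 1"
    and D\<phi>: "\<And>y. y \<ge> 0 \<Longrightarrow> (\<phi> has_real_derivative clamp y (v y)) (at y within {0..})"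
    and Dv: "\<And>y. y \<ge> 0 \<Longrightarrow> (v has_real_derivative
       y * clamp y (v y) / 2 - \<gamma> * \<phi> y - clamp y (v y) powr p) (at y within {0..})"
    and y: "y \<ge> 0"
  shows "v y > lower y"
    and "\<beta> * v y + y * (y * v y / 2 - \<gamma> * \<phi> y - clamp y (v y) powr p) > 0"
proof -
  define w where "w y = clamp y (v y)" for y
  define E where "E y = y * v y / 2 - \<gamma> * \<phi> y" for y
  define h where "h y = \<beta> * v y + y * (E y - w y powr p)" for y
  have cont: "continuous_on {0..} v" "continuous_on {0..} \<phi>"
    using Dv D\<phi> by (auto simp: continuous_on_eq_continuous_within intro: DERIV_continuous)
  have contw: "continuous_on {0..} w" unfolding w_def by (intro continuous_clamp cont)
  have contl: "continuous_on {0..} lower"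
    by (auto simp: continuous_on_eq_continuous_within intro!: DERIV_continuous[OF D_lower])
  have conth: "continuous_on {0..} h"
    unfolding h_def E_def by (intro continuous_intros cont contw) (auto simp: w_def clamp_nonzero)
  have "min (v y - lower y) (h y) > 0"
  proof (rule positive_if_no_first_zero[where f="\<lambda>y. min (v y - lower y) (h y)" and a=0])
    show "continuous_on {0..} (\<lambda>y. min (v y - lower y) (h y))"
      by (intro continuous_intros cont contl conth)
    have "(2::real) powr - \<beta> < 1"
      using \<beta>_pos by (simp add: powr_less_one)
    then show "min (v 0 - lower 0) (h 0) > 0"
      using \<beta>_pos by (simp add: v0 h_def lower_def)
  next
    fix T :: real assume T: "T > 0" and pos: "\<And>y. y \<in> {0..<T} \<Longrightarrow> min (v y - lower y) (h y) > 0"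
      and zero: "min (v T - lower T) (h T) = 0"
    have ge: "v z \<ge> lower z" if "z \<in> {0..T}" for z
      using pos[of z] zero that by (cases "z = T") auto
    have wv: "w z = v z" if "z \<in> {0..T}" for z
      using ge[OF that] truncated_lt_upper[OF \<phi>0 v0 D\<phi> Dv, of z] that by (auto simp: w_def clamp_def)
    have v_pos: "v z > 0" if "z \<in> {0..T}" for z
      using ge[OF that] lower_pos[of z] that by auto
    define v' where "v' z = E z - v z powr p" for z
    have Dv': "(v has_real_derivative v' z) (at z within {0..})" if "z \<in> {0..T}" for z
      using Dv[of z] wv[OF that] that by (simp add: w_def v'_def E_def)
    have h_eq: "h z = \<beta> * v z + z * v' z" if "z \<in> {0..T}" for z
      using wv[OF that] by (simp add: h_def v'_def)
    have DE: "(E has_real_derivative h z / 2) (at z within {0..})" if z: "z \<in> {0..T}" for z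
    proof -
      have "(E has_real_derivative (v z + z * v' z) / 2 - \<gamma> * v z) (at z within {0..})"
        unfolding E_def using D\<phi>[of z] wv[OF z] Dv'[OF z] z
        by (auto intro!: derivative_eq_intros simp: w_def)
      moreover have "(v z + z * v' z) / 2 - \<gamma> * v z = h z / 2"
        by (simp add: h_eq[OF z] \<gamma>_mult field_simps)
      ultimately show ?thesis by simp
    qed
    have "E 0 < E T"
    proof (rule DERIV_pos_imp_increasing_open[OF T])
      show "continuous_on {0..T} E"
        unfolding E_def by (intro continuous_intros continuous_on_subset[OF cont(1)] continuous_on_subset[OF cont(2)]) auto
      fix z assume "0 < z" "z < T"
      then show "\<exists>D. (E has_real_derivative D) (at z) \<and> D > 0"
        using DE[of z] pos[of z] by (intro exI[of _ "h z / 2"]) (auto simp: at_within_atLeast_interior)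
    qed
    then have ET: "E T > 0" by (simp add: E_def \<phi>0)
    have sub: "{0..T} \<subseteq> {0..}" by auto
    have T_in: "T \<in> {0..T}" using T by simp
    note D_at_T = Dv'[OF T_in, THEN DERIV_subset, OF sub] DE[OF T_in, THEN DERIV_subset, OF sub]
    consider "v T = lower T" | "h T = 0" using zero by linarith
    then show False
    proof cases
      case 1
      \<comment> \<open>At a contact the derivatives of \<open>v\<close> and \<open>lower\<close>
        differ by exactly \<open>E T > 0\<close>.\<close>
      have "((\<lambda>z. v z - lower z) has_real_derivative v' T - - (lower T powr p)) (at T within {0..T})"
        using T by (intro DERIV_diff D_at_T D_lower) auto
      moreover have "v' T - - (lower T powr p) > 0" using 1 ET by (simp add: v'_def)
      ultimately have "\<exists>z\<in>{0..<T}. v z - lower z < 0"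
        using T 1 by (intro negative_before_increasing_zero) auto
      then show False using pos by (metis min_less_iff_conj less_asym)
    next
      case 2
      \<comment> \<open>Here \<open>h T = 0\<close> and \<open>E T > 0\<close> force
        \<open>g > \<beta>\<close>. With \<open>p * \<beta> = \<beta> + 1\<close> the derivative of
        \<open>h\<close> at \<open>T\<close> becomes \<open>p * ((\<beta> - g) * v' T)\<close>,
        where both \<open>\<beta> - g\<close> and \<open>v' T\<close> are negative.\<close>
      define g where "g = T * v T powr (p - 1)"
      have vp: "v T powr p = v T * v T powr (p - 1)"
        using v_pos[OF T_in] by (simp add: powr_mult_base)
      have "h T = T * E T + v T * (\<beta> - g)"
        by (simp add: h_eq[OF T_in] v'_def vp g_def algebra_simps)
      then have "v T * (\<beta> - g) < 0" using 2 T ET by (smt (verit) mult_pos_pos)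
      then have g: "g > \<beta>" using v_pos[OF T_in] by (simp add: mult_less_0_iff)
      define D where "D = \<beta> * v' T + (v' T + T * (h T / 2 - p * v T powr (p - 1) * v' T))"
      have "((\<lambda>z. \<beta> * v z + z * (E z - v z powr p)) has_real_derivative D) (at T within {0..T})"
        unfolding D_def using v_pos[OF T_in] D_at_T
        by (auto intro!: derivative_eq_intros simp: v'_def)
      \<comment> \<open>\<open>h\<close> contains the clamped value, which is known to equal
        \<open>v\<close> only up to \<open>T\<close>; hence the left derivative.\<close>
      then have "(h has_real_derivative D) (at T within {0..T})"
        by (rule has_field_derivative_transform_within[OF _ zero_less_one]) (use T wv in \<open>auto simp: h_def\<close>)
      moreover have "D > 0"
      proof -
        have "D = (\<beta> + 1) * v' T - p * g * v' T"
          by (simp add: D_def 2 g_def algebra_simps)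
        also have "\<dots> = p * \<beta> * v' T - p * g * v' T" by (simp only: p_mult)
        also have "\<dots> = p * ((\<beta> - g) * v' T)" by (simp add: algebra_simps)
        finally have "D = p * ((\<beta> - g) * v' T)" .
        moreover have "T * v' T < 0" using 2 h_eq[OF T_in] \<beta>_pos v_pos[OF T_in]
          by (smt (verit) mult_pos_pos)
        then have "v' T < 0" using T by (simp add: mult_less_0_iff)
        ultimately show ?thesis using g p by (simp add: mult_neg_neg)
      qed
      ultimately have "\<exists>z\<in>{0..<T}. h z < 0"
        using T 2 by (intro negative_before_increasing_zero) auto
      then show False using pos by (metis min_less_iff_conj less_asym)
    qed
  qed (use y in auto)
  then show "v y > lower y" "\<beta> * v y + y * (y * v y / 2 - \<gamma> * \<phi> y - clamp y (v y) powr p) > 0"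
    by (auto simp: h_def E_def w_def)
qed

text \<open>Strictly between \<open>lower\<close> and \<open>upper\<close> clamping is the identity,
  so the truncated solution solves the original system.\<close>

lemma profile_exists:
  obtains \<phi> v where "\<phi> 0 = 0"
    "\<And>y. y \<ge> 0 \<Longrightarrow> (\<phi> has_real_derivative v y) (at y within {0..})"
    "\<And>y. y \<ge> 0 \<Longrightarrow> (v has_real_derivative y * v y / 2 - \<gamma> * \<phi> y - v y powr p) (at y within {0..})"
    "\<And>y. y \<ge> 0 \<Longrightarrow> v y > 0"
    "\<And>y. y \<ge> 0 \<Longrightarrow> \<beta> * v y + y * (y * v y / 2 - \<gamma> * \<phi> y - v y powr p) > 0"
proof -
  obtain \<phi> v where sol: "\<phi> 0 = 0" "v 0 = 1"
    "\<And>y. y \<ge> 0 \<Longrightarrow> (\<phi> has_real_derivative clamp y (v y)) (at y within {0..})"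
    "\<And>y. y \<ge> 0 \<Longrightarrow> (v has_real_derivative
       y * clamp y (v y) / 2 - \<gamma> * \<phi> y - clamp y (v y) powr p) (at y within {0..})"
    using truncated_solution by blast
  have clamp: "clamp y (v y) = v y" if "y \<ge> 0" for y
    using truncated_lt_upper[OF sol that] truncated_stays_above(1)[OF sol that] by (simp add: clamp_def)
  show thesis
  proof (rule that[of \<phi> v])
    fix y :: real assume y: "y \<ge> 0"
    show "v y > 0" using truncated_stays_above(1)[OF sol y] lower_pos[OF y] by simp
  qed (use sol clamp truncated_stays_above(2)[OF sol] in \<open>force+\<close>)
qed

end

section \<open>Asymptotics of the profile\<close>

locale profile = profile_constants +
  fixes \<phi> v :: "real \<Rightarrow> real"
  assumes \<phi>_0: "\<phi> 0 = 0"
    and D\<phi>: "\<And>y. y \<ge> 0 \<Longrightarrow> (\<phi> has_real_derivative v y) (at y within {0..})"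
    and Dv: "\<And>y. y \<ge> 0 \<Longrightarrow>
      (v has_real_derivative y * v y / 2 - \<gamma> * \<phi> y - v y powr p) (at y within {0..})"
    and v_pos: "\<And>y. y \<ge> 0 \<Longrightarrow> v y > 0"
    and scaled_pos: "\<And>y. y \<ge> 0 \<Longrightarrow> \<beta> * v y + y * (y * v y / 2 - \<gamma> * \<phi> y - v y powr p) > 0"
begin

text \<open>The second derivative of the profile, taken from the equation so that its own regularity
  can be read off.\<close>

definition v' :: "real \<Rightarrow> real" where "v' y = y * v y / 2 - \<gamma> * \<phi> y - v y powr p"

lemma scaled_pos': "y \<ge> 0 \<Longrightarrow> \<beta> * v y + y * v' y > 0"
  using scaled_pos[of y] by (simp add: v'_def)

lemma continuous_profile: "continuous_on {0..} \<phi>" "continuous_on {0..} v" "continuous_on {0..} v'"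
proof -
  show c: "continuous_on {0..} \<phi>" "continuous_on {0..} v"
    using Dv D\<phi> by (auto simp: continuous_on_eq_continuous_within intro: DERIV_continuous)
  show "continuous_on {0..} v'"
    unfolding v'_def using v_pos by (intro continuous_intros c) force+
qed

lemma D_interior:
  assumes "y > 0"
  shows "(\<phi> has_real_derivative v y) (at y)" "(v has_real_derivative v' y) (at y)"
  using D\<phi>[of y] Dv[of y] assms by (auto simp: at_within_atLeast_interior v'_def)

lemma D_v':
  assumes "y > 0"
  shows "(v' has_real_derivative \<beta> / 2 * v y + y / 2 * v' y - p * v y powr (p - 1) * v' y) (at y)"
proof -
  have "(v' has_real_derivative (v y + y * v' y) / 2 - \<gamma> * v y - p * v y powr (p - 1) * v' y) (at y)"
    unfolding v'_def[abs_def] using assms v_pos[of y] D_interior[OF assms]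
    by (auto intro!: derivative_eq_intros simp: v'_def)
  then show ?thesis by (rule DERIV_cong) (simp add: \<gamma>_mult field_simps)
qed

text \<open>\<open>E\<close> is increasing, so \<open>E \<ge> E 1 > 0\<close> from 1 on. At a level
  \<open>c\<close> with \<open>c powr p < E 1\<close> the equation \<open>v' = E - v powr p\<close>
  pushes \<open>v\<close> upwards, so \<open>c\<close> is a barrier.\<close>

lemma v_bounded_below:
  obtains c where "c > 0" "\<And>y. y \<ge> 1 \<Longrightarrow> v y > c"
proof -
  define E where "E y = y * v y / 2 - \<gamma> * \<phi> y" for y
  have DE: "(E has_real_derivative (\<beta> * v y + y * v' y) / 2) (at y within {0..})" if "y \<ge> 0" for y
  proof -
    have "(E has_real_derivative (v y + y * v' y) / 2 - \<gamma> * v y) (at y within {0..})"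
      unfolding E_def using D\<phi>[OF that] Dv[OF that]
      by (auto intro!: derivative_eq_intros simp: v'_def)
    then show ?thesis by (rule DERIV_cong) (simp add: \<gamma>_mult field_simps)
  qed
  have DE_pos: "(\<beta> * v y + y * v' y) / 2 > 0" if "y \<ge> 0" for y
    using scaled_pos'[OF that] by simp
  have "E 0 < E 1"
  proof (rule DERIV_pos_imp_increasing_open[of 0 1 E])
    show "continuous_on {0..1} E"
      unfolding E_def
      by (intro continuous_intros continuous_on_subset[OF continuous_profile(1)]
          continuous_on_subset[OF continuous_profile(2)]) auto
    fix z :: real assume "0 < z" "z < 1"
    then show "\<exists>D. (E has_real_derivative D) (at z) \<and> D > 0"
      using DE[of z] DE_pos[of z] by (auto simp: at_within_atLeast_interior)
  qed simp
  then have E1: "E 1 > 0" by (simp add: E_def \<phi>_0)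
  have E_ge: "E y \<ge> E 1" if "y \<ge> 1" for y
    using that DE_pos by (intro mono_if_deriv_nonneg_atLeast[OF DE]) (auto simp: less_imp_le)
  define c where "c = min (v 1) (E 1 powr (1/p)) / 2"
  have c: "c > 0" "c < v 1" "c < E 1 powr (1/p)"
    using v_pos[of 1] E1 powr_gt_zero[of "E 1" "1/p"] by (auto simp: c_def min_def simp del: powr_gt_zero)
  have "c powr p < (E 1 powr (1/p)) powr p" using c p by (intro powr_less_mono2) auto
  then have cE: "c powr p < E 1" using E1 p by (simp add: powr_powr)
  have "v y - c > 0" if "y \<ge> 1" for y
  proof (rule trapped_positive[of 1 "\<lambda>y. v y - c" v'])
    show "((\<lambda>y. v y - c) has_real_derivative v' z) (at z)" if "z \<ge> 1" for z
      using that by (auto intro!: derivative_eq_intros D_interior)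
    show "v' z > 0" if "z > 1" "v z - c = 0" for z
      using that cE E_ge[of z] by (simp add: v'_def E_def)
  qed (use c that in auto)
  then show ?thesis using that[of c] c by force
qed

text \<open>For \<open>S\<close> this is \<open>y * S' / S = (p - 1) * r - 1\<close> with
  \<open>p - 1 = 1 / \<beta>\<close>; for \<open>r\<close> it is the quotient rule with
  \<open>D_v'\<close>. The growth condition holds because \<open>v > c\<close> gives
  \<open>y\<^sup>2 * S \<ge> p * c powr (p - 1) * y\<close>.\<close>

lemma log_derivative_system_profile:
  "log_derivative_system \<beta> (\<lambda>y. y * v' y / v y) (\<lambda>y. p * v y powr (p - 1) / y)"
proof
  show "\<beta> > 0" by (rule \<beta>_pos)
  fix y :: real assume y: "y \<ge> 1"
  have vy: "v y > 0" using v_pos y by simp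
  show "p * v y powr (p - 1) / y > 0" using vy y p by simp
  show "y * v' y / v y > - \<beta>"
    using scaled_pos'[of y] vy y by (simp add: field_simps)
  have "((\<lambda>y. p * v y powr (p - 1) / y) has_real_derivative
     (p * ((p - 1) * v y powr (p - 1 - 1) * v' y) * y - p * v y powr (p - 1)) / (y * y)) (at y)"
    using vy y D_interior[of y] by (auto intro!: derivative_eq_intros)
  moreover have "(p * ((p - 1) * v y powr (p - 1 - 1) * v' y) * y - p * v y powr (p - 1)) / (y * y)
     = p * v y powr (p - 1) / y * (y * v' y / v y - \<beta>) / (\<beta> * y)"
  proof -
    have powr: "v y powr (p - 1 - 1) = v y powr (p - 1) / v y"
      using vy powr_diff[of "v y" "p - 1" 1] by simp
    have quot: "(p * (q * (a / b) * c) * y - p * a) / (y * y) = p * a / y * ((q * (y * c / b) - 1) / y)"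
      for a b c q :: real
      using y by (simp add: diff_divide_distrib algebra_simps)
    have "p - 1 = 1 / \<beta>" using \<beta>_mult \<beta>_pos by (simp add: field_simps)
    then have slope: "((p - 1) * x - 1) / y = (x - \<beta>) / (\<beta> * y)" for x
      using y \<beta>_pos by (simp only:) (simp add: field_simps)
    show ?thesis unfolding powr quot slope by simp
  qed
  ultimately show "((\<lambda>y. p * v y powr (p - 1) / y) has_real_derivative
     p * v y powr (p - 1) / y * (y * v' y / v y - \<beta>) / (\<beta> * y)) (at y)" by (rule DERIV_cong)
  \<comment> \<open>\<open>a\<close>, \<open>b\<close>, \<open>q\<close> stand for
    \<open>v' y\<close>, \<open>v y\<close> and \<open>p * v y powr (p - 1)\<close>. Substituting
    \<open>a = c * b\<close> removes the division by \<open>b\<close>.\<close>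
  have quot: "((a + y * (\<beta> / 2 * b + y / 2 * a - q * a)) * b - y * a * a) / (b * b)
     = (y * a / b - (y * a / b)\<^sup>2) / y + y * (\<beta> / 2 + (1/2 - q / y) * (y * a / b))"
    if b: "b > 0" for a b q :: real
  proof -
    define c where "c = a / b"
    have a: "a = c * b" using b by (simp add: c_def)
    have "(a + y * (\<beta> / 2 * b + y / 2 * a - q * a)) * b - y * a * a
        = (c + y * (\<beta> / 2 + y / 2 * c - q * c) - y * c * c) * (b * b)"
      by (simp add: a algebra_simps)
    then have "((a + y * (\<beta> / 2 * b + y / 2 * a - q * a)) * b - y * a * a) / (b * b)
        = c + y * (\<beta> / 2 + y / 2 * c - q * c) - y * c * c"
      using b by simp
    moreover have "y * a / b = y * c" by (simp add: c_def)
    moreover have "(y * c - (y * c)\<^sup>2) / y = c - y * c * c"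
      using y by (simp add: diff_divide_distrib power2_eq_square)
    moreover have "(1/2 - q / y) * (y * c) = y / 2 * c - q * c"
      using y by (simp add: left_diff_distrib)
    ultimately show ?thesis by simp
  qed
  have "((\<lambda>y. y * v' y / v y) has_real_derivative
     ((v' y + y * (\<beta> / 2 * v y + y / 2 * v' y - p * v y powr (p - 1) * v' y)) * v y - y * v' y * v' y)
       / (v y * v y)) (at y)"
    using vy y D_interior[of y] D_v'[of y] by (auto intro!: derivative_eq_intros)
  then show "((\<lambda>y. y * v' y / v y) has_real_derivative
     (y * v' y / v y - (y * v' y / v y)\<^sup>2) / y
       + y * (\<beta> / 2 + (1/2 - p * v y powr (p - 1) / y) * (y * v' y / v y))) (at y)"
    unfolding quot[OF vy] .
next
  obtain c where c: "c > 0" "\<And>y. y \<ge> 1 \<Longrightarrow> v y > c" using v_bounded_below by blast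
  have "filterlim (\<lambda>y. (p * c powr (p - 1)) * y) at_top at_top"
    using c p by (intro filterlim_tendsto_pos_mult_at_top[OF tendsto_const] filterlim_ident) auto
  then show "filterlim (\<lambda>y. y\<^sup>2 * (p * v y powr (p - 1) / y)) at_top at_top"
  proof (rule filterlim_at_top_mono)
    show "\<forall>\<^sub>F y in at_top. p * c powr (p - 1) * y \<le> y\<^sup>2 * (p * v y powr (p - 1) / y)"
      using eventually_ge_at_top[of 1]
    proof eventually_elim
      case (elim y)
      have "c powr (p - 1) \<le> v y powr (p - 1)" using c elim p by (intro powr_mono2) (auto simp: less_imp_le)
      then have "p * c powr (p - 1) * y \<le> p * v y powr (p - 1) * y"
        using elim p by (intro mult_right_mono mult_left_mono) auto
      then show ?case using elim by (simp add: power2_eq_square mult_ac)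
    qed
  qed
qed

text \<open>That \<open>S\<close> tends to 1 means that \<open>v\<close> is asymptotic to
  \<open>(y / p) powr \<beta>\<close>; l'Hospital's rule transfers this to \<open>\<phi>\<close>
  with the factor \<open>1 / (\<beta> + 1)\<close>.\<close>

lemma profile_tendsto:
  "((\<lambda>y. \<phi> y / y powr (\<beta> + 1)) \<longlongrightarrow> (1/p) powr \<beta> / (\<beta> + 1)) at_top"
proof (rule lhospital_at_top_at_top)
  show "filterlim (\<lambda>y::real. y powr (\<beta> + 1)) at_top at_top"
  proof (rule filterlim_at_top_mono[OF filterlim_ident])
    show "\<forall>\<^sub>F y::real in at_top. y \<le> y powr (\<beta> + 1)"
      using eventually_ge_at_top[of 1]
    proof eventually_elim
      case (elim y)
      then show ?case using powr_mono[of 1 "\<beta> + 1" y] \<beta>_pos by simp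
    qed
  qed
  show "\<forall>\<^sub>F y in at_top. (\<beta> + 1) * y powr \<beta> \<noteq> 0"
    using eventually_gt_at_top[of 0] by eventually_elim (use \<beta>_pos in auto)
  show "\<forall>\<^sub>F y in at_top. (\<phi> has_real_derivative v y) (at y)"
    using eventually_gt_at_top[of 0] by eventually_elim (rule D_interior)
  show "\<forall>\<^sub>F y in at_top. ((\<lambda>y. y powr (\<beta> + 1)) has_real_derivative (\<beta> + 1) * y powr \<beta>) (at y)"
    using eventually_gt_at_top[of 0]
    by eventually_elim (use has_real_derivative_powr[of _ "\<beta> + 1"] in simp)
  have "((\<lambda>y. p * v y powr (p - 1) / y) \<longlongrightarrow> 1) at_top"
    by (rule log_derivative_system.S_tendsto[OF log_derivative_system_profile])
  \<comment> \<open>Because \<open>(p - 1) * \<beta> = 1\<close>, the power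
    \<open>(S / p) powr \<beta>\<close> equals \<open>v / y powr \<beta>\<close>.\<close>
  then have "((\<lambda>y. ((p * v y powr (p - 1) / y) / p) powr \<beta> / (\<beta> + 1))
      \<longlongrightarrow> (1/p) powr \<beta> / (\<beta> + 1)) at_top"
    using p \<beta>_pos by (intro tendsto_intros) auto
  then show "((\<lambda>y. v y / ((\<beta> + 1) * y powr \<beta>)) \<longlongrightarrow> (1/p) powr \<beta> / (\<beta> + 1)) at_top"
  proof (rule Lim_transform_eventually)
    show "\<forall>\<^sub>F y in at_top. ((p * v y powr (p - 1) / y) / p) powr \<beta> / (\<beta> + 1)
        = v y / ((\<beta> + 1) * y powr \<beta>)"
      using eventually_gt_at_top[of 0]
    proof eventually_elim
      case (elim y)
      then show ?case using v_pos[of y] p \<beta>_mult by (simp add: powr_divide powr_powr mult.commute)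
    qed
  qed
qed

end

section \<open>The self-similar solution\<close>

text \<open>Exponent and profile are parameters because differentiation preserves this shape: a
  normal derivative lowers the exponent by \<open>1/2\<close>, a time derivative by
  \<open>1\<close>.\<close>

definition selfsimilar :: "real \<Rightarrow> (real \<Rightarrow> real) \<Rightarrow> 'n::finite \<Rightarrow> real^'n \<Rightarrow> real \<Rightarrow> real" where
  "selfsimilar a F k x t = \<bar>t\<bar> powr a * F (x $ k / sqrt \<bar>t\<bar>)"

lemma continuous_on_selfsimilar:
  assumes "continuous_on {0..} F" "A \<subseteq> halfQbar k"
  shows "continuous_on A (\<lambda>(x, t). selfsimilar a F k x t)"
proof -
  have A: "fst z $ k \<ge> 0" "snd z < 0" if "z \<in> A" for z
    using assms(2) that by (auto simp: halfQbar_def)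
  have "continuous_on A (\<lambda>z. F (fst z $ k / sqrt \<bar>snd z\<bar>))"
    by (rule continuous_on_compose2[OF assms(1)]) (auto intro!: continuous_intros dest: A)
  then show ?thesis
    unfolding selfsimilar_def case_prod_unfold by (intro continuous_intros) (auto dest: A)
qed

lemma selfsimilar_D_space:
  fixes x :: "real^'n::finite"
  assumes "t < 0" "(F has_real_derivative F' (x $ k / sqrt \<bar>t\<bar>)) (at (x $ k / sqrt \<bar>t\<bar>))"
  shows "((\<lambda>s. selfsimilar a F k (x + s *\<^sub>R axis i 1) t) has_real_derivative
    (if i = k then selfsimilar (a - 1/2) F' k x t else 0)) (at 0)"
proof (cases "i = k")
  case True
  have "((\<lambda>s. F ((x $ k + s) / sqrt \<bar>t\<bar>)) has_real_derivative F' (x $ k / sqrt \<bar>t\<bar>) * (1 / sqrt \<bar>t\<bar>)) (at 0)"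
  proof (rule DERIV_chain2[where f=F and g="\<lambda>s. (x $ k + s) / sqrt \<bar>t\<bar>" and x=0])
    show "(F has_real_derivative F' (x $ k / sqrt \<bar>t\<bar>)) (at ((x $ k + 0) / sqrt \<bar>t\<bar>))"
      using assms(2) by simp
    show "((\<lambda>s. (x $ k + s) / sqrt \<bar>t\<bar>) has_real_derivative 1 / sqrt \<bar>t\<bar>) (at 0)"
      by (rule DERIV_cdivide) (auto intro!: derivative_eq_intros)
  qed
  from DERIV_cmult[OF this, of "\<bar>t\<bar> powr a"]
  have "((\<lambda>s. \<bar>t\<bar> powr a * F ((x $ k + s) / sqrt \<bar>t\<bar>)) has_real_derivative
      \<bar>t\<bar> powr a * (F' (x $ k / sqrt \<bar>t\<bar>) * (1 / sqrt \<bar>t\<bar>))) (at 0)" .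
  moreover have "\<bar>t\<bar> powr (a - 1/2) = \<bar>t\<bar> powr a / sqrt \<bar>t\<bar>"
    using assms(1) by (simp add: powr_diff powr_half_sqrt)
  ultimately show ?thesis using True by (simp add: selfsimilar_def axis_def mult_ac)
next
  case False
  then have "selfsimilar a F k (x + s *\<^sub>R axis i 1) t = selfsimilar a F k x t" for s
    by (simp add: selfsimilar_def axis_def)
  with False show ?thesis by simp
qed

text \<open>The similarity variable \<open>y = x $ k / sqrt (- t)\<close> has time derivative
  \<open>y / (2 * (- t))\<close>, so both terms of the product rule carry
  \<open>(- t) powr (a - 1)\<close>.\<close>

lemma selfsimilar_D_time:
  fixes x :: "real^'n::finite"
  assumes "t < 0" "(F has_real_derivative F' (x $ k / sqrt \<bar>t\<bar>)) (at (x $ k / sqrt \<bar>t\<bar>))"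
  shows "((\<lambda>s. selfsimilar a F k x (t + s)) has_real_derivative
    selfsimilar (a - 1) (\<lambda>y. y * F' y / 2 - a * F y) k x t) (at 0)"
proof -
  define y where "y = x $ k / sqrt (- t)"
  have "((\<lambda>s. x $ k / sqrt (- (t + s))) has_real_derivative y / (2 * (- t))) (at 0)"
    using assms(1) by (auto intro!: derivative_eq_intros simp: y_def divide_simps power2_eq_square)
  moreover have "(F has_real_derivative F' y) (at (x $ k / sqrt (- (t + 0))))"
    using assms by (simp add: y_def)
  ultimately have DF: "((\<lambda>s. F (x $ k / sqrt (- (t + s)))) has_real_derivative F' y * (y / (2 * (- t)))) (at 0)"
    by (rule DERIV_chain2[rotated])
  have "((\<lambda>s. (- (t + s)) powr a) has_real_derivative - a * (- t) powr (a - 1)) (at 0)"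
    using assms(1) by (auto intro!: derivative_eq_intros simp: powr_diff)
  from DERIV_mult[OF this DF]
  have "((\<lambda>s. (- (t + s)) powr a * F (x $ k / sqrt (- (t + s)))) has_real_derivative
      - a * (- t) powr (a - 1) * F (x $ k / sqrt (- (t + 0)))
      + F' y * (y / (2 * (- t))) * (- (t + 0)) powr a) (at 0)" .
  moreover have "(- t) powr a = (- t) powr (a - 1) * (- t)"
    using assms(1) by (simp add: powr_diff)
  then have "- a * (- t) powr (a - 1) * F (x $ k / sqrt (- (t + 0)))
      + F' y * (y / (2 * (- t))) * (- (t + 0)) powr a
      = (- t) powr (a - 1) * (y * F' y / 2 - a * F y)"
    using assms(1) by (simp add: y_def[symmetric] field_simps)
  ultimately have "((\<lambda>s. (- (t + s)) powr a * F (x $ k / sqrt (- (t + s)))) has_real_derivative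
      selfsimilar (a - 1) (\<lambda>y. y * F' y / 2 - a * F y) k x t) (at 0)"
    using assms(1) by (simp add: selfsimilar_def y_def)
  \<comment> \<open>The computation replaced \<open>\<bar>t + s\<bar>\<close> by
    \<open>- (t + s)\<close>, which is right for \<open>s < - t\<close>, a neighbourhood of
    0.\<close>
  then show ?thesis
  proof (rule has_field_derivative_transform_within_open[where S="{..<- t}"])
    show "(- (t + s)) powr a * F (x $ k / sqrt (- (t + s))) = selfsimilar a F k x (t + s)"
      if "s \<in> {..<- t}" for s
      using that by (simp add: selfsimilar_def)
  qed (use assms in auto)
qed

section \<open>Verification of the equation, positivity and dependence on time\<close>

context profile
begin

lemma \<phi>_pos:
  assumes "y > 0"
  shows "\<phi> y > 0"
proof -
  have "\<phi> 0 < \<phi> y"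
  proof (rule DERIV_pos_imp_increasing_open[OF assms])
    show "\<exists>D. (\<phi> has_real_derivative D) (at x) \<and> D > 0" if "0 < x" for x
      using that D_interior(1)[of x] v_pos[of x] by auto
    show "continuous_on {0..y} \<phi>"
      by (rule continuous_on_subset[OF continuous_profile(1)]) auto
  qed
  then show ?thesis by (simp add: \<phi>_0)
qed

context
  fixes k :: "'n::finite" and u :: "real^'n \<Rightarrow> real \<Rightarrow> real"
  assumes u_eq: "u = selfsimilar \<gamma> \<phi> k"
begin

lemma D_u:
  assumes "(x, t) \<in> halfQ k"
  shows "((\<lambda>s. u (x + s *\<^sub>R axis i 1) t) has_real_derivative
      (if i = k then selfsimilar (\<gamma> - 1/2) v k x t else 0)) (at 0)"
    and "((\<lambda>s. u x (t + s)) has_real_derivative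
      selfsimilar (\<gamma> - 1) (\<lambda>y. y * v y / 2 - \<gamma> * \<phi> y) k x t) (at 0)"
  unfolding u_eq using assms
  by (auto simp only: halfQ_def mem_Collect_eq case_prod_conv
      intro!: selfsimilar_D_space selfsimilar_D_time D_interior divide_pos_pos real_sqrt_gt_zero)

lemma dx_u: "(x, t) \<in> halfQ k \<Longrightarrow> dx i u x t = (if i = k then selfsimilar (\<gamma> - 1/2) v k x t else 0)"
  and dt_u: "(x, t) \<in> halfQ k \<Longrightarrow> dt u x t = selfsimilar (\<gamma> - 1) (\<lambda>y. y * v y / 2 - \<gamma> * \<phi> y) k x t"
  unfolding dx_def dt_def by (intro DERIV_imp_deriv D_u; assumption)+

lemma D_dx_u:
  assumes "(x, t) \<in> halfQ k"
  shows "((\<lambda>s. dx j u (x + s *\<^sub>R axis i 1) t) has_real_derivative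
      (if i = k \<and> j = k then selfsimilar (\<gamma> - 1) v' k x t else 0)) (at 0)"
proof -
  have xt: "x $ k > 0" "t < 0" using assms by (auto simp: halfQ_def)
  \<comment> \<open>The formula \<open>dx_u\<close> is available only in the half-space, so
    \<open>s\<close> is restricted to an open set that keeps the point there.\<close>
  define S where "S = {s. x $ k + s * axis i 1 $ k > 0}"
  have S: "open S" "0 \<in> S"
    unfolding S_def using xt by (auto intro!: open_Collect_less continuous_intros)
  have "((\<lambda>s. selfsimilar (\<gamma> - 1/2) v k (x + s *\<^sub>R axis i 1) t) has_real_derivative
      (if i = k then selfsimilar (\<gamma> - 1/2 - 1/2) v' k x t else 0)) (at 0)"
    using xt by (intro selfsimilar_D_space D_interior divide_pos_pos) auto
  then have "((\<lambda>s. if j = k then selfsimilar (\<gamma> - 1/2) v k (x + s *\<^sub>R axis i 1) t else 0) has_real_derivative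
      (if i = k \<and> j = k then selfsimilar (\<gamma> - 1) v' k x t else 0)) (at 0)"
    by (cases "j = k"; cases "i = k") simp_all
  then show ?thesis
    by (rule has_field_derivative_transform_within_open[OF _ S])
       (use xt in \<open>auto simp: S_def halfQ_def dx_u\<close>)
qed

lemma dx_dx_u: "(x, t) \<in> halfQ k \<Longrightarrow>
    dx i (dx j u) x t = (if i = k \<and> j = k then selfsimilar (\<gamma> - 1) v' k x t else 0)"
  unfolding dx_def[of i "dx j u"] by (intro DERIV_imp_deriv D_dx_u)

lemma C21_on_u: "C21_on (halfQ k) u"
proof -
  have sub: "halfQ k \<subseteq> halfQbar k" by (auto simp: halfQ_def halfQbar_def)
  note c = continuous_on_selfsimilar[OF _ sub]
  have "continuous_on (halfQ k) (\<lambda>(x, t). u x t)"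
    unfolding u_eq by (intro c continuous_profile)
  moreover have "continuous_on (halfQ k) (\<lambda>(x, t). dx i u x t)" for i
  proof (rule continuous_on_eq)
    show "continuous_on (halfQ k) (\<lambda>(x, t). if i = k then selfsimilar (\<gamma> - 1/2) v k x t else 0)"
      using c[OF continuous_profile(2)] by (cases "i = k") (simp_all add: case_prod_unfold)
  qed (auto simp: dx_u)
  moreover have "continuous_on (halfQ k) (\<lambda>(x, t). dx i (dx j u) x t)" for i j
  proof (rule continuous_on_eq)
    show "continuous_on (halfQ k)
        (\<lambda>(x, t). if i = k \<and> j = k then selfsimilar (\<gamma> - 1) v' k x t else 0)"
      using c[OF continuous_profile(3)] by (cases "i = k \<and> j = k") (auto simp: case_prod_unfold)
  qed (auto simp: dx_dx_u)
  moreover have "continuous_on (halfQ k) (\<lambda>(x, t). dt u x t)"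
  proof (rule continuous_on_eq)
    show "continuous_on (halfQ k)
        (\<lambda>(x, t). selfsimilar (\<gamma> - 1) (\<lambda>y. y * v y / 2 - \<gamma> * \<phi> y) k x t)"
      by (intro c continuous_intros continuous_profile) auto
  qed (auto simp: dt_u)
  moreover have "(\<lambda>s. u (x + s *\<^sub>R axis i 1) t) field_differentiable (at 0)"
    "(\<lambda>s. dx j u (x + s *\<^sub>R axis i 1) t) field_differentiable (at 0)"
    "(\<lambda>s. u x (t + s)) field_differentiable (at 0)" if "(x, t) \<in> halfQ k" for x t i j
    unfolding field_differentiable_def using D_u[OF that] D_dx_u[OF that] by blast+
  ultimately show ?thesis
    unfolding C21_on_def by blast
qed

text \<open>All terms scale like \<open>\<bar>t\<bar> powr (\<gamma> - 1)\<close>, the gradient term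
  because \<open>(\<gamma> - 1/2) * p = \<gamma> - 1\<close>. What remains is the profile
  equation.\<close>

lemma u_pde:
  assumes "(x, t) \<in> halfQ k"
  shows "dt u x t - laplacian u x t = grad_norm u x t powr p"
proof -
  have xt: "x $ k > 0" "t < 0" using assms by (auto simp: halfQ_def)
  define y where "y = x $ k / sqrt \<bar>t\<bar>"
  have y: "y > 0" using xt by (simp add: y_def)
  then have vy: "v y > 0" by (simp add: v_pos)
  have lap: "laplacian u x t = \<bar>t\<bar> powr (\<gamma> - 1) * v' y"
    unfolding laplacian_def dx_dx_u[OF assms] by (simp add: selfsimilar_def y_def)
  have "(\<Sum>i\<in>UNIV. (dx i u x t)\<^sup>2) = (\<Sum>i\<in>UNIV. if i = k then (\<bar>t\<bar> powr (\<gamma> - 1/2) * v y)\<^sup>2 else 0)"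
    unfolding dx_u[OF assms] by (intro sum.cong) (auto simp: selfsimilar_def y_def)
  then have "grad_norm u x t = \<bar>t\<bar> powr (\<gamma> - 1/2) * v y"
    using vy by (simp add: grad_norm_def)
  moreover have "(\<gamma> - 1/2) * p = \<gamma> - 1"
    using p_mult by (simp add: \<gamma>_def field_simps)
  ultimately have "grad_norm u x t powr p = \<bar>t\<bar> powr (\<gamma> - 1) * v y powr p"
    using vy by (simp add: powr_mult powr_powr)
  moreover have "dt u x t = \<bar>t\<bar> powr (\<gamma> - 1) * (y * v y / 2 - \<gamma> * \<phi> y)"
    unfolding dt_u[OF assms] by (simp add: selfsimilar_def y_def)
  ultimately show ?thesis
    unfolding lap by (simp add: v'_def algebra_simps)
qed

lemma ancient_solution_u: "ancient_solution p k u"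
proof -
  have "continuous_on (halfQbar k) (\<lambda>(x, t). u x t)"
    unfolding u_eq by (intro continuous_on_selfsimilar continuous_profile order_refl)
  moreover have "u x t = 0" if "x $ k = 0" for x t
    using that by (simp add: u_eq selfsimilar_def \<phi>_0)
  ultimately show ?thesis
    unfolding ancient_solution_def using C21_on_u u_pde by auto
qed

lemma u_pos: "(x, t) \<in> halfQ k \<Longrightarrow> u x t > 0"
  by (auto simp: u_eq selfsimilar_def halfQ_def intro!: mult_pos_pos \<phi>_pos)

text \<open>Stationarity would force \<open>\<phi> y = \<phi> 1 * y powr (1 - \<beta>)\<close>, so
  that \<open>\<phi> y / y powr (\<beta> + 1)\<close> would tend to 0 instead of a positive
  limit.\<close>

lemma u_not_stationary: "\<not> (\<forall>(x, t)\<in>halfQ k. \<forall>s < 0. u x s = u x t)"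
proof
  assume stat: "\<forall>(x, t)\<in>halfQ k. \<forall>s < 0. u x s = u x t"
  have \<phi>_eq: "\<phi> y / y powr (\<beta> + 1) = \<phi> 1 * y powr (- 2 * \<beta>)" if y: "y > 0" for y
  proof -
    \<comment> \<open>At the point \<open>axis k 1\<close> and time \<open>- (1 / y\<^sup>2)\<close>
      the similarity variable is \<open>y\<close>; at time \<open>-1\<close> it is 1.\<close>
    have "(axis k 1, -1) \<in> halfQ k" by (simp add: halfQ_def axis_def)
    from bspec[OF stat this] have "\<forall>s<0. u (axis k 1) s = u (axis k 1) (-1)"
      unfolding case_prod_conv .
    moreover have "- (1 / y\<^sup>2) < 0" using y by simp
    ultimately have "u (axis k 1) (- (1 / y\<^sup>2)) = u (axis k 1) (-1)"
      by blast
    then have "(1 / y\<^sup>2) powr \<gamma> * \<phi> y = \<phi> 1"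
      using y by (simp add: u_eq selfsimilar_def axis_def real_sqrt_divide)
    moreover have "(1 / y\<^sup>2) powr \<gamma> = y powr (\<beta> - 1)"
    proof -
      have "1 / y\<^sup>2 = y powr (-2)" using y by (simp add: powr_minus_divide)
      moreover have "- (2 * \<gamma>) = \<beta> - 1" by (simp add: \<gamma>_def field_simps)
      ultimately show ?thesis by (simp add: powr_powr)
    qed
    ultimately have "\<phi> 1 * y powr (- 2 * \<beta>) = y powr (\<beta> - 1) * y powr (- 2 * \<beta>) * \<phi> y" by simp
    also have "y powr (\<beta> - 1) * y powr (- 2 * \<beta>) = y powr (- (\<beta> + 1))"
      by (simp add: powr_add[symmetric])
    finally show ?thesis unfolding powr_minus_divide by simp
  qed
  have "((\<lambda>y. \<phi> 1 * y powr (- 2 * \<beta>)) \<longlongrightarrow> \<phi> 1 * 0) at_top"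
    using \<beta>_pos by (intro tendsto_intros tendsto_neg_powr filterlim_ident) auto
  then have "((\<lambda>y. \<phi> y / y powr (\<beta> + 1)) \<longlongrightarrow> \<phi> 1 * 0) at_top"
  proof (rule Lim_transform_eventually)
    show "\<forall>\<^sub>F y in at_top. \<phi> 1 * y powr (- 2 * \<beta>) = \<phi> y / y powr (\<beta> + 1)"
      using eventually_gt_at_top[of 0] by eventually_elim (simp add: \<phi>_eq)
  qed
  from tendsto_unique[OF _ this profile_tendsto] show False
    using p \<beta>_pos by simp
qed

end

end

theorem theorem2p4:
  fixes p :: real and k :: "'n::finite"
  assumes "p > 1"
  defines "\<beta> \<equiv> 1 / (p - 1)"
      and "\<gamma> \<equiv> (p - 2) / (2 * (p - 1))"
  shows "\<exists>u :: real^'n \<Rightarrow> real \<Rightarrow> real.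
           ancient_solution p k u \<and>
           (\<forall>(x, t)\<in>halfQ k. u x t > 0) \<and>
           \<not> (\<forall>(x, t)\<in>halfQ k. \<forall>s < 0. u x s = u x t) \<and>
           (\<exists>\<phi> \<phi>' \<phi>'' :: real \<Rightarrow> real. \<exists>L :: real.
              (\<forall>y\<ge>0. (\<phi> has_real_derivative \<phi>' y) (at y within {0..})) \<and>
              (\<forall>y\<ge>0. (\<phi>' has_real_derivative \<phi>'' y) (at y within {0..})) \<and>
              continuous_on {0..} \<phi>'' \<and>
              \<phi> 0 = 0 \<and> (\<forall>y\<ge>0. \<phi>' y > 0) \<and>
              L > 0 \<and> ((\<lambda>y. \<phi> y / y powr (\<beta> + 1)) \<longlongrightarrow> L) at_top \<and>
              (\<forall>(x, t)\<in>halfQ k. u x t = \<bar>t\<bar> powr \<gamma> * \<phi> (x $ k / sqrt \<bar>t\<bar>)))"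
proof -
  \<comment> \<open>Here \<open>(p - 2) / (2 * (p - 1))\<close> is rewritten as
    \<open>(1 - \<beta>) / 2\<close>.\<close>
  interpret profile_constants p \<beta> \<gamma>
    using assms by unfold_locales (auto simp: field_simps)
  obtain \<phi> v where \<phi>v: "profile p \<beta> \<gamma> \<phi> v"
    using profile_exists unfolding profile_def profile_axioms_def
    by (metis profile_constants_axioms)
  interpret profile p \<beta> \<gamma> \<phi> v by (rule \<phi>v)
  let ?u = "selfsimilar \<gamma> \<phi> k"
  show ?thesis
  proof (intro exI[of _ ?u] conjI)
    show "ancient_solution p k ?u" by (rule ancient_solution_u[OF refl])
    show "\<forall>(x, t)\<in>halfQ k. ?u x t > 0" using u_pos[OF refl] by blast
    show "\<not> (\<forall>(x, t)\<in>halfQ k. \<forall>s < 0. ?u x s = ?u x t)" by (rule u_not_stationary[OF refl])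
    show "\<exists>\<phi> \<phi>' \<phi>'' :: real \<Rightarrow> real. \<exists>L :: real.
        (\<forall>y\<ge>0. (\<phi> has_real_derivative \<phi>' y) (at y within {0..})) \<and>
        (\<forall>y\<ge>0. (\<phi>' has_real_derivative \<phi>'' y) (at y within {0..})) \<and>
        continuous_on {0..} \<phi>'' \<and>
        \<phi> 0 = 0 \<and> (\<forall>y\<ge>0. \<phi>' y > 0) \<and>
        L > 0 \<and> ((\<lambda>y. \<phi> y / y powr (\<beta> + 1)) \<longlongrightarrow> L) at_top \<and>
        (\<forall>(x, t)\<in>halfQ k. ?u x t = \<bar>t\<bar> powr \<gamma> * \<phi> (x $ k / sqrt \<bar>t\<bar>))"
    proof (rule exI[of _ \<phi>], rule exI[of _ v], rule exI[of _ v'],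
        rule exI[of _ "(1/p) powr \<beta> / (\<beta> + 1)"], intro conjI)
      show "\<forall>y\<ge>0. (v has_real_derivative v' y) (at y within {0..})" using Dv by (simp add: v'_def)
      show "(1/p) powr \<beta> / (\<beta> + 1) > 0" using p \<beta>_pos by simp
    qed (use D\<phi> \<phi>_0 v_pos continuous_profile(3) profile_tendsto in \<open>auto simp: selfsimilar_def\<close>)
  qed
qed

end
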